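(* Let $j\ge 3$ and $0\le i\le j$ be integers, and let $X$ be a transitive subshift with exactly $j$ minimal subsystems, exactly $i$ of which are infinite. Then $$\limsup_{n\to\infty}(c_X(n)-(j+i)n)=\infty.$$ Moreover, this bound is sharp: for all integers $j\ge 3$, $0\le i\le j$, and every nondecreasing unbounded function $g:\mathbb N\to\mathbb N$, there exists a transitive subshift $X$ with exactly $j$ minimal subsystems, exactly $i$ of which are infinite, for which $\limsup_{n\to\infty}\big(c_X(n)-((j+i)n+g(n))\big)=\infty$ is false.
   Context: A subshift is a closed, $\sigma$-invariant subset $X\subset\mathcal A^{\mathbb Z}$, where $\mathcal A$ is a finite alphabet, $\mathcal A^{\mathbb Z}$ carries the product topology, and $\sigma(x)_k=x_{k+1}$ is the left shift. A word of length $n$ in $X$ is a block $x_k x_{k+1}\cdots x_{k+n-1}$ occurring in some $x\in X$; $c_X(n)$ is the number of words of length $n$ in $X$. The orbit of $x$ is $\mathcal O(x)=\{\sigma^n(x):n\in\mathbb Z\}$; $X$ is transitive if $X=\overline{\mathcal O(x)}$ for some $x\in X$ (not necessarily recurrent), and minimal if $X=\overline{\mathcal O(x)}$ for every $x\in X$. A minimal subsystem of $X$ is a subshift contained in $X$ that is minimal. *)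

theory Defs
  imports "HOL-Analysis.Analysis"
begin

text \<open>The alphabet is a finite set \<open>A\<close> rather than a type, so that a statement can assert the
  existence of a subshift over some finite alphabet.\<close>

definition full_shift :: "'a set \<Rightarrow> (int \<Rightarrow> 'a) topology" where
  "full_shift A = product_topology (\<lambda>_. discrete_topology A) UNIV"

text \<open>\<open>shift n\<close> is the \<open>n\<close>-th power, for any integer \<open>n\<close>, of the left shift \<open>shift 1\<close>.\<close>

definition shift :: "int \<Rightarrow> (int \<Rightarrow> 'a) \<Rightarrow> (int \<Rightarrow> 'a)" where
  "shift n x = (\<lambda>k. x (k + n))"

definition orbit :: "(int \<Rightarrow> 'a) \<Rightarrow> (int \<Rightarrow> 'a) set" where
  "orbit x = {shift n x | n. True}"

definition subshift :: "'a set \<Rightarrow> (int \<Rightarrow> 'a) set \<Rightarrow> bool" where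
  "subshift A X \<longleftrightarrow> finite A \<and> closedin (full_shift A) X \<and> shift 1 ` X = X"

definition transitive_subshift :: "'a set \<Rightarrow> (int \<Rightarrow> 'a) set \<Rightarrow> bool" where
  "transitive_subshift A X \<longleftrightarrow> subshift A X \<and> (\<exists>x\<in>X. X = full_shift A closure_of orbit x)"

text \<open>The empty set is not counted as a minimal subshift.\<close>

definition minimal_subshift :: "'a set \<Rightarrow> (int \<Rightarrow> 'a) set \<Rightarrow> bool" where
  "minimal_subshift A X \<longleftrightarrow>
     subshift A X \<and> X \<noteq> {} \<and> (\<forall>x\<in>X. X = full_shift A closure_of orbit x)"

definition minimal_subsystems :: "'a set \<Rightarrow> (int \<Rightarrow> 'a) set \<Rightarrow> (int \<Rightarrow> 'a) set set" where
  "minimal_subsystems A X = {Y. minimal_subshift A Y \<and> Y \<subseteq> X}"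

definition words :: "(int \<Rightarrow> 'a) set \<Rightarrow> nat \<Rightarrow> 'a list set" where
  "words X n = {map (\<lambda>m. x (k + int m)) [0..<n] | x k. x \<in> X}"

definition complexity :: "(int \<Rightarrow> 'a) set \<Rightarrow> nat \<Rightarrow> nat" where
  "complexity X n = card (words X n)"

end

theory Submission
  imports Defs "HOL-Library.Sublist"
begin

text \<open>Fix a point \<open>x\<close> with dense orbit. The languages of distinct minimal subsystems are disjoint at
  every large level \<open>n\<close>, and at such a level some word of length \<open>n + 1\<close> of \<open>x\<close> exits each of
  them: since \<open>j \<ge> 3\<close>, two of the languages recur on the same side of \<open>x\<close>, say the right one. Each
  exit adds one to \<open>c (n + 1) - c n\<close> beyond the growth of the language itself, so this difference is at
  least \<open>j + i\<close>. If it were equal to \<open>j + i\<close> from some level on, then exits would be unique and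
  words outside the languages would have unique right extensions; counting to the left, some
  recurrent language would have a unique entry, this entry would extend uniquely at all higher levels,
  and \<open>x\<close> would never leave the language again.

  For sharpness, let \<open>i\<close> of the subsystems be Fibonacci subshifts and the others fixed points, on
  disjoint alphabets. The point \<open>x\<close> is asymptotic to the subsystem \<open>0\<close> on the left, and on the right it
  visits the other ones cyclically, during rapidly increasing times. The visited words are at the
  same time prefixes and suffixes of each other, so all long transitions look alike. Counting words is
  only needed when \<open>n\<close> is the length of a visit, because \<open>c n - (j + i) * n\<close> is eventually
  nondecreasing.\<close>

section \<open>Counting exits and entries\<close>

definition block :: "(int \<Rightarrow> 'a) \<Rightarrow> int \<Rightarrow> nat \<Rightarrow> 'a list" where
  "block x k n = map (\<lambda>m. x (k + int m)) [0..<n]"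

definition factors :: "(int \<Rightarrow> 'a) \<Rightarrow> 'a list set" where
  "factors x = {block x k n | k n. True}"

definition level :: "'a list set \<Rightarrow> nat \<Rightarrow> 'a list set" where
  "level L n = {w \<in> L. length w = n}"

text \<open>Over a finite alphabet these are the languages of nonempty subshifts: factorial and
  extendable on both sides. Asking for the empty word excludes the empty set, which has the other
  properties vacuously.\<close>

definition ext_lang :: "'a list set \<Rightarrow> bool" where
  "ext_lang L \<longleftrightarrow> [] \<in> L \<and> (\<forall>u v w. u @ v @ w \<in> L \<longrightarrow> v \<in> L)
     \<and> (\<forall>w\<in>L. \<exists>a. w @ [a] \<in> L) \<and> (\<forall>w\<in>L. \<exists>a. a # w \<in> L)"

lemma length_block [simp]: "length (block x k n) = n"
  by (simp add: block_def)

lemma nth_block: "m < n \<Longrightarrow> block x k n ! m = x (k + int m)"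
  by (simp add: block_def)

lemma block_0 [simp]: "block x k 0 = []"
  by (simp add: block_def)

lemma block_add: "block x k (m + n) = block x k m @ block x (k + int m) n"
  by (rule nth_equalityI) (auto simp: nth_append nth_block algebra_simps)

lemma block_Suc: "block x k (Suc n) = block x k n @ [x (k + int n)]"
  by (simp add: block_def)

lemma block_Suc': "block x k (Suc n) = x k # block x (k + 1) n"
  using block_add[of x k 1 n] by (simp add: block_def)

lemma butlast_block [simp]: "butlast (block x k (Suc n)) = block x k n"
  by (simp add: block_Suc)

lemma tl_block [simp]: "tl (block x k (Suc n)) = block x (k + 1) n"
  by (simp add: block_Suc')

lemma take_block: "m \<le> n \<Longrightarrow> take m (block x k n) = block x k m"
  using block_add[of x k m "n - m"] by simp

lemma block_sub:
  assumes "u @ v @ w = block x k n"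
  shows "v = block x (k + int (length u)) (length v)"
proof -
  have n: "n = length u + (length v + length w)"
    using assms by (metis length_append length_block)
  show ?thesis
    using assms unfolding n block_add by (metis append_eq_append_conv length_block)
qed

lemma block_in_factors [simp]: "block x k n \<in> factors x"
  by (auto simp: factors_def)

lemma factorsE:
  assumes "w \<in> factors x"
  obtains k where "w = block x k (length w)"
  using assms by (auto simp: factors_def)

lemma ext_lang_factors: "ext_lang (factors x)"
  unfolding ext_lang_def
proof (intro conjI allI impI ballI)
  show "[] \<in> factors x" by (metis block_0 block_in_factors)
next
  fix u v w assume "u @ v @ w \<in> factors x"
  then show "v \<in> factors x" by (metis block_in_factors block_sub factorsE)
next
  fix w assume "w \<in> factors x"
  then obtain k where "w = block x k (length w)" by (rule factorsE)
  then show "\<exists>a. w @ [a] \<in> factors x" by (metis block_Suc block_in_factors)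
next
  fix w assume "w \<in> factors x"
  then obtain k where "w = block x k (length w)" by (rule factorsE)
  then show "\<exists>a. a # w \<in> factors x"
    using block_Suc'[of x "k - 1"] by (metis block_in_factors diff_add_cancel)
qed

lemma ext_langD:
  assumes "ext_lang L"
  shows "u @ v @ w \<in> L \<Longrightarrow> v \<in> L" "w @ [a] \<in> L \<Longrightarrow> w \<in> L"
    "w \<in> L \<Longrightarrow> butlast w \<in> L" "w \<in> L \<Longrightarrow> tl w \<in> L"
proof -
  have *: "\<And>u v w. u @ v @ w \<in> L \<Longrightarrow> v \<in> L" using assms unfolding ext_lang_def by blast
  show "u @ v @ w \<in> L \<Longrightarrow> v \<in> L" by (rule *)
  show "w @ [a] \<in> L \<Longrightarrow> w \<in> L" using *[of "[]" w "[a]"] by simp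
  show "w \<in> L \<Longrightarrow> butlast w \<in> L"
    using *[of "[]" "butlast w" "[last w]"] by (cases "w = []") auto
  show "w \<in> L \<Longrightarrow> tl w \<in> L"
    using *[of "[hd w]" "tl w" "[]"] by (cases "w = []") auto
qed

lemma ext_langE:
  assumes "ext_lang L" "w \<in> L"
  obtains a b where "w @ [a] \<in> L" "b # w \<in> L"
  using assms unfolding ext_lang_def by blast

lemma ext_lang_sub_block:
  assumes "ext_lang L" "block x k n \<in> L" "k \<le> l" "l + int m \<le> k + int n"
  shows "block x l m \<in> L"
proof -
  define a where "a = nat (l - k)"
  define b where "b = n - a - m"
  have n: "n = a + (m + b)" and l: "l = k + int a"
    using assms(3,4) by (auto simp: a_def b_def)
  show ?thesis using assms(2) ext_langD(1)[OF assms(1)]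
    unfolding n block_add l by metis
qed

lemma ext_lang_level_nonempty:
  assumes "ext_lang L" shows "level L n \<noteq> {}"
proof (induction n)
  case 0 then show ?case using assms by (auto simp: level_def ext_lang_def)
next
  case (Suc n)
  then obtain w where "w \<in> L" "length w = n" by (auto simp: level_def)
  moreover then obtain a where "w @ [a] \<in> L" using assms ext_langE by metis
  ultimately have "w @ [a] \<in> level L (Suc n)" by (auto simp: level_def)
  then show ?case by blast
qed

lemma butlast_level:
  assumes "ext_lang L" shows "butlast ` level L (Suc n) = level L n"
proof
  show "butlast ` level L (Suc n) \<subseteq> level L n"
    using ext_langD(3)[OF assms] by (auto simp: level_def)
  show "level L n \<subseteq> butlast ` level L (Suc n)"
  proof
    fix w assume w: "w \<in> level L n"
    then have "w \<in> L" by (simp add: level_def)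
    with assms obtain a where "w @ [a] \<in> L" using ext_langE by metis
    with w show "w \<in> butlast ` level L (Suc n)"
      by (intro image_eqI[of _ _ "w @ [a]"]) (auto simp: level_def)
  qed
qed

lemma tl_level:
  assumes "ext_lang L" shows "tl ` level L (Suc n) = level L n"
proof
  show "tl ` level L (Suc n) \<subseteq> level L n"
    using ext_langD(4)[OF assms] by (auto simp: level_def)
  show "level L n \<subseteq> tl ` level L (Suc n)"
  proof
    fix w assume w: "w \<in> level L n"
    then have "w \<in> L" by (simp add: level_def)
    with assms obtain a where "a # w \<in> L" using ext_langE by metis
    with w show "w \<in> tl ` level L (Suc n)"
      by (intro image_eqI[of _ _ "a # w"]) (auto simp: level_def)
  qed
qed

lemma level_factors: "level (factors x) n = range (\<lambda>k. block x k n)"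
  by (auto simp: level_def factors_def)

lemma finite_level_factors:
  assumes "finite (range x)" shows "finite (level (factors x) n)"
proof (rule finite_subset)
  show "level (factors x) n \<subseteq> {w. set w \<subseteq> range x \<and> length w = n}"
    by (auto simp: level_factors block_def)
  show "finite {w. set w \<subseteq> range x \<and> length w = n}"
    using finite_lists_length_eq[OF assms] .
qed

text \<open>In the applications \<open>P\<close> and \<open>Q\<close> consist of the words of
  lengths \<open>n\<close> and \<open>n + 1\<close>, \<open>\<pi>\<close> deletes a letter at one
  end, and \<open>S0\<close>, \<open>S1\<close> are two consecutive levels of a language. Fibres
  over the disjoint sets \<open>S0 m\<close> are counted exactly; every other element of
  \<open>P\<close> has at least one preimage. The additive form avoids subtraction of
  naturals.\<close>

lemma fibre_count:
  assumes fin: "finite Q" "finite I" and surj: "\<pi> ` Q = P"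
    and S0: "\<And>m. m \<in> I \<Longrightarrow> S0 m \<subseteq> P"
    and disj: "\<And>m m'. m \<in> I \<Longrightarrow> m' \<in> I \<Longrightarrow> m \<noteq> m' \<Longrightarrow> S0 m \<inter> S0 m' = {}"
    and S1: "\<And>m. m \<in> I \<Longrightarrow> S1 m \<subseteq> Q" "\<And>m. m \<in> I \<Longrightarrow> \<pi> ` S1 m \<subseteq> S0 m"
  shows "card P + (\<Sum>m\<in>I. card (S1 m)) + (\<Sum>m\<in>I. card {u \<in> Q. \<pi> u \<in> S0 m \<and> u \<notin> S1 m})
           \<le> card Q + (\<Sum>m\<in>I. card (S0 m))"
proof -
  define U where "U = (\<Union>m\<in>I. S0 m)"
  define Q1 where "Q1 = {u \<in> Q. \<pi> u \<in> U}"
  have finP: "finite P" using fin surj by blast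
  have UP: "U \<subseteq> P" using S0 by (auto simp: U_def)
  have cardU: "card U = (\<Sum>m\<in>I. card (S0 m))" unfolding U_def
    using fin S0 disj finP by (intro card_UN_disjoint) (auto intro: finite_subset)
  have "Q1 = (\<Union>m\<in>I. {u \<in> Q. \<pi> u \<in> S0 m})" by (auto simp: Q1_def U_def)
  then have "card Q1 = (\<Sum>m\<in>I. card {u \<in> Q. \<pi> u \<in> S0 m})"
    using fin disj by (simp only:) (rule card_UN_disjoint; fastforce)
  also have "\<dots> = (\<Sum>m\<in>I. card (S1 m) + card {u \<in> Q. \<pi> u \<in> S0 m \<and> u \<notin> S1 m})"
  proof (rule sum.cong[OF refl])
    fix m assume m: "m \<in> I"
    have "{u \<in> Q. \<pi> u \<in> S0 m} = S1 m \<union> {u \<in> Q. \<pi> u \<in> S0 m \<and> u \<notin> S1 m}"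
      using S1[OF m] by auto
    then show "card {u \<in> Q. \<pi> u \<in> S0 m} = card (S1 m) + card {u \<in> Q. \<pi> u \<in> S0 m \<and> u \<notin> S1 m}"
      using fin(1) S1(1)[OF m] by (simp only:) (rule card_Un_disjoint; auto intro: finite_subset)
  qed
  finally have Q1: "card Q1 = (\<Sum>m\<in>I. card (S1 m)) + (\<Sum>m\<in>I. card {u \<in> Q. \<pi> u \<in> S0 m \<and> u \<notin> S1 m})"
    by (simp add: sum.distrib)
  have "P - U \<subseteq> \<pi> ` (Q - Q1)" using surj by (auto simp: Q1_def)
  then have "card (P - U) \<le> card (Q - Q1)" using surj_card_le[OF finite_Diff[OF fin(1)]] by simp
  moreover have "card P = card (P - U) + card U"
    using UP finP by (metis card_Diff_subset card_mono finite_subset le_add_diff_inverse2)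
  moreover have "card Q = card (Q - Q1) + card Q1"
    using fin(1) by (metis (no_types, lifting) Q1_def card_Diff_subset card_mono finite_subset le_add_diff_inverse2 mem_Collect_eq subsetI)
  ultimately show ?thesis using Q1 cardU by linarith
qed

section \<open>Languages visited by a point, with their exits and entries\<close>

definition strictly_growing :: "'a list set \<Rightarrow> bool" where
  "strictly_growing L \<longleftrightarrow> (\<forall>n. card (level L n) < card (level L (Suc n)))"

text \<open>It need not be the same word of \<open>L\<close> that recurs. For the language of a
  subshift over a finite alphabet, the condition says that the omega-limit set of \<open>x\<close>
  meets the subshift.\<close>

definition right_recurrent :: "(int \<Rightarrow> 'a) \<Rightarrow> 'a list set \<Rightarrow> bool" where
  "right_recurrent x L \<longleftrightarrow> (\<forall>n K. \<exists>k\<ge>K. block x k n \<in> L)"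

text \<open>Recurrence is assumed on the right only; a point with two languages recurring on the
  left is treated through its reversal.\<close>

locale visited_languages =
  fixes x :: "int \<Rightarrow> 'a" and \<L> :: "'a list set set" and N :: nat
  assumes finite_range: "finite (range x)"
    and finite_\<L>: "finite \<L>"
    and lang: "L \<in> \<L> \<Longrightarrow> ext_lang L"
    and visited: "L \<in> \<L> \<Longrightarrow> L \<subseteq> factors x"
    and disjoint: "L \<in> \<L> \<Longrightarrow> L' \<in> \<L> \<Longrightarrow> w \<in> L \<Longrightarrow> w \<in> L' \<Longrightarrow> N \<le> length w \<Longrightarrow> L = L'"
    and two_recurrent: "\<exists>L\<in>\<L>. \<exists>L'\<in>\<L>. L \<noteq> L' \<and> right_recurrent x L \<and> right_recurrent x L'"
begin

definition cx :: "nat \<Rightarrow> nat" where "cx n = card (level (factors x) n)"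

text \<open>The tail of an exit may lie in \<open>L\<close> again, so \<open>x\<close> can pass
  through an exit while its windows of length \<open>n\<close> remain in \<open>L\<close>.\<close>

definition exits :: "'a list set \<Rightarrow> nat \<Rightarrow> 'a list set" where
  "exits L n = {u \<in> level (factors x) (Suc n). butlast u \<in> L \<and> u \<notin> L}"

definition entries :: "'a list set \<Rightarrow> nat \<Rightarrow> 'a list set" where
  "entries L n = {u \<in> level (factors x) (Suc n). tl u \<in> L \<and> u \<notin> L}"

definition grow :: nat where
  "grow = card {L \<in> \<L>. strictly_growing L}"

lemma finite_level_fx: "finite (level (factors x) n)"
  by (rule finite_level_factors[OF finite_range])

lemma finite_level: "L \<in> \<L> \<Longrightarrow> finite (level L n)"
  using visited[of L] by (intro finite_subset[OF _ finite_level_fx[of n]]) (auto simp: level_def)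

lemma finite_exits: "finite (exits L n)" and finite_entries: "finite (entries L n)"
  using finite_level_fx[of "Suc n"] by (auto simp: exits_def entries_def)

lemma level_mono: "L \<in> \<L> \<Longrightarrow> card (level L n) \<le> card (level L (Suc n))"
  using butlast_level[OF lang] finite_level by (metis card_image_le)

lemma sum_level_grow:
  "(\<Sum>L\<in>\<L>. card (level L n)) + grow \<le> (\<Sum>L\<in>\<L>. card (level L (Suc n)))"
proof -
  have "grow = (\<Sum>L\<in>\<L>. if strictly_growing L then 1 else 0)"
    using finite_\<L> by (simp add: grow_def sum.If_cases Int_def)
  then have "(\<Sum>L\<in>\<L>. card (level L n)) + grow
      = (\<Sum>L\<in>\<L>. card (level L n) + (if strictly_growing L then 1 else 0))"
    by (simp add: sum.distrib)
  also have "\<dots> \<le> (\<Sum>L\<in>\<L>. card (level L (Suc n)))"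
    using level_mono by (intro sum_mono) (auto simp: strictly_growing_def Suc_leI)
  finally show ?thesis .
qed

lemma level_disjoint:
  "\<lbrakk>L \<in> \<L>; L' \<in> \<L>; L \<noteq> L'; N \<le> n\<rbrakk> \<Longrightarrow> level L n \<inter> level L' n = {}"
  using disjoint by (fastforce simp: level_def)

text \<open>For \<open>\<pi> = butlast\<close> the last sum counts the exits, for
  \<open>\<pi> = tl\<close> the entries.\<close>

lemma count_fibres:
  assumes "N \<le> n" and "\<And>L. ext_lang L \<Longrightarrow> \<pi> ` level L (Suc n) = level L n"
  shows "cx n + grow + (\<Sum>L\<in>\<L>. card {u \<in> level (factors x) (Suc n). \<pi> u \<in> level L n \<and> u \<notin> L}) \<le> cx (Suc n)"
proof -
  let ?Q = "level (factors x) (Suc n)"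
  have "cx n + (\<Sum>L\<in>\<L>. card (level L (Suc n)))
        + (\<Sum>L\<in>\<L>. card {u \<in> ?Q. \<pi> u \<in> level L n \<and> u \<notin> level L (Suc n)})
      \<le> cx (Suc n) + (\<Sum>L\<in>\<L>. card (level L n))"
    unfolding cx_def
  proof (rule fibre_count)
    fix L assume L: "L \<in> \<L>"
    show "level L n \<subseteq> level (factors x) n" "level L (Suc n) \<subseteq> ?Q"
      using visited[OF L] by (auto simp: level_def)
    show "\<pi> ` level L (Suc n) \<subseteq> level L n" using assms(2) lang[OF L] by blast
  qed (simp_all add: finite_level_fx finite_\<L> assms(2) ext_lang_factors level_disjoint[OF _ _ _ assms(1)])
  moreover have "{u \<in> ?Q. \<pi> u \<in> level L n \<and> u \<notin> level L (Suc n)}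
      = {u \<in> ?Q. \<pi> u \<in> level L n \<and> u \<notin> L}" for L
    by (auto simp: level_def)
  ultimately show ?thesis using sum_level_grow[of n] by simp
qed

lemma count_exits:
  assumes "N \<le> n"
  shows "cx n + grow + (\<Sum>L\<in>\<L>. card (exits L n)) \<le> cx (Suc n)"
proof -
  have "exits L n = {u \<in> level (factors x) (Suc n). butlast u \<in> level L n \<and> u \<notin> L}" for L
    by (auto simp: exits_def level_def)
  then show ?thesis using count_fibres[OF assms, of butlast, OF butlast_level] by simp
qed

lemma count_entries:
  assumes "N \<le> n"
  shows "cx n + grow + (\<Sum>L\<in>\<L>. card (entries L n)) \<le> cx (Suc n)"
proof -
  have "entries L n = {u \<in> level (factors x) (Suc n). tl u \<in> level L n \<and> u \<notin> L}" for L
    by (auto simp: entries_def level_def)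
  then show ?thesis using count_fibres[OF assms, of tl, OF tl_level] by simp
qed

text \<open>A right special word \<open>w\<close> outside the languages is accounted for by adding the two-word
  set \<open>{w, w @ [a]}\<close> to the family, with \<open>w @ [b]\<close> as its exit.\<close>

lemma count_special:
  assumes "N \<le> length w" "\<And>L. L \<in> \<L> \<Longrightarrow> w \<notin> L"
    "w @ [a] \<in> factors x" "w @ [b] \<in> factors x" "a \<noteq> b"
  shows "cx (length w) + grow + (\<Sum>L\<in>\<L>. card (exits L (length w))) < cx (Suc (length w))"
proof -
  define n where "n = length w"
  define S where "S = {w, w @ [a]}"
  have S\<L>: "S \<notin> \<L>" using assms(2) by (auto simp: S_def)
  have lS: "level S n = {w}" "level S (Suc n) = {w @ [a]}" by (auto simp: level_def S_def n_def)
  have wf: "w \<in> factors x" by (rule ext_langD(2)[OF ext_lang_factors assms(3)])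
  let ?Q = "level (factors x) (Suc n)"
  let ?E = "\<lambda>L. {u \<in> ?Q. butlast u \<in> level L n \<and> u \<notin> level L (Suc n)}"
  have "cx n + (\<Sum>L\<in>insert S \<L>. card (level L (Suc n))) + (\<Sum>L\<in>insert S \<L>. card (?E L))
      \<le> cx (Suc n) + (\<Sum>L\<in>insert S \<L>. card (level L n))"
    unfolding cx_def
  proof (rule fibre_count)
    fix L L' assume LL: "L \<in> insert S \<L>" "L' \<in> insert S \<L>" "L \<noteq> L'"
    have "w \<notin> level M n" if "M \<in> \<L>" for M using assms(2)[OF that] by (simp add: level_def)
    moreover have "N \<le> n" using assms(1) by (simp add: n_def)
    ultimately show "level L n \<inter> level L' n = {}"
      using level_disjoint[of L L' n] LL lS(1) by (metis disjoint_insert(2) inf_bot_right inf_commute insertE)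
  next
    fix L assume L: "L \<in> insert S \<L>"
    show "level L n \<subseteq> level (factors x) n"
    proof (cases "L = S")
      case True then show ?thesis using lS(1) wf by (simp add: level_def n_def)
    next
      case False then show ?thesis using L visited[of L] by (auto simp: level_def)
    qed
    show "level L (Suc n) \<subseteq> ?Q"
    proof (cases "L = S")
      case True then show ?thesis using lS(2) assms(3) by (simp add: level_def n_def)
    next
      case False then show ?thesis using L visited[of L] by (auto simp: level_def)
    qed
    show "butlast ` level L (Suc n) \<subseteq> level L n"
      using L lS butlast_level[OF lang] by (cases "L = S") auto
  qed (simp_all add: finite_level_fx finite_\<L> butlast_level[OF ext_lang_factors])
  then have "cx n + 1 + (\<Sum>L\<in>\<L>. card (level L (Suc n))) + card (?E S) + (\<Sum>L\<in>\<L>. card (?E L))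
      \<le> cx (Suc n) + 1 + (\<Sum>L\<in>\<L>. card (level L n))"
    using finite_\<L> S\<L> lS by simp
  moreover have "w @ [b] \<in> ?E S" using lS assms(4,5) by (auto simp: level_def n_def)
  then have "card (?E S) > 0" using finite_level_fx[of "Suc n"] card_gt_0_iff[of "?E S"] by auto
  moreover have "?E L = exits L n" for L by (auto simp: exits_def level_def)
  ultimately have "cx n + grow + (\<Sum>L\<in>\<L>. card (exits L n)) < cx (Suc n)"
    using sum_level_grow[of n] by simp
  then show ?thesis by (simp add: n_def)
qed

lemma occurs:
  assumes "L \<in> \<L>" obtains k where "block x k n \<in> L"
proof -
  obtain w where "w \<in> L" "length w = n"
    using ext_lang_level_nonempty[OF lang[OF assms], of n] by (auto simp: level_def)
  then show thesis using visited[OF assms] that by (metis factorsE subsetD)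
qed

text \<open>One of the two right recurrent languages differs from \<open>L\<close>, and its words of
  length \<open>n\<close>, met arbitrarily far to the right, are not in \<open>L\<close>.\<close>

lemma leave:
  assumes "L \<in> \<L>" "N \<le> n"
  shows "\<exists>l\<ge>k. block x l n \<notin> L"
proof -
  obtain L' where "L' \<in> \<L>" "L' \<noteq> L" "right_recurrent x L'" using two_recurrent by metis
  moreover then obtain l where "l \<ge> k" "block x l n \<in> L'" unfolding right_recurrent_def by blast
  ultimately show ?thesis using disjoint assms by (metis length_block)
qed

text \<open>Without exits, one window of \<open>x\<close> in \<open>L\<close> would force all later
  windows of length \<open>n\<close> into \<open>L\<close>, against \<open>leave\<close>.\<close>

lemma exits_nonempty:
  assumes "L \<in> \<L>" "N \<le> n"
  shows "exits L n \<noteq> {}"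
proof
  assume e: "exits L n = {}"
  obtain k where k: "block x k n \<in> L" using occurs[OF assms(1)] .
  have "block x l n \<in> L" if "l \<ge> k" for l
    using that
  proof (induction l rule: int_ge_induct)
    case (step l)
    have "block x l (Suc n) \<notin> exits L n" using e by blast
    then have "block x l (Suc n) \<in> L" using step by (auto simp: exits_def level_def)
    then show ?case using ext_langD(4)[OF lang[OF assms(1)]] by fastforce
  qed (rule k)
  then show False using leave[OF assms] by blast
qed

lemma sum_exits_ge: "N \<le> n \<Longrightarrow> card \<L> \<le> (\<Sum>L\<in>\<L>. card (exits L n))"
proof -
  assume n: "N \<le> n"
  have "card \<L> = (\<Sum>L\<in>\<L>. 1)" by simp
  also have "\<dots> \<le> (\<Sum>L\<in>\<L>. card (exits L n))"
    using exits_nonempty[OF _ n] finite_exits by (intro sum_mono) (simp add: Suc_leI card_gt_0_iff)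
  finally show ?thesis .
qed

theorem growth: "N \<le> n \<Longrightarrow> cx n + card \<L> + grow \<le> cx (Suc n)"
  using count_exits[of n] sum_exits_ge[of n] by linarith

lemma no_entries_left_closed:
  assumes "L \<in> \<L>" "entries L n = {}" "block x k n \<in> L" "l \<le> k"
  shows "block x l n \<in> L"
  using assms(4)
proof (induction l rule: int_le_induct)
  case (step l)
  have "block x (l - 1) (Suc n) \<notin> entries L n" using assms by blast
  then have "block x (l - 1) (Suc n) \<in> L" using step by (auto simp: entries_def level_def)
  then show ?case using ext_langD(3)[OF lang[OF assms(1)]] by fastforce
qed (use assms in simp)

text \<open>A language containing all windows far to the left may have no entries. Right recurrence
  rules this out, because a window outside \<open>L\<close> is then followed by one in
  \<open>L\<close>.\<close>

lemma entries_nonempty: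
  assumes "L \<in> \<L>" "N \<le> n" "right_recurrent x L"
  shows "entries L n \<noteq> {}"
proof
  assume e: "entries L n = {}"
  obtain l where l: "block x l n \<notin> L" using leave[OF assms(1,2)] by blast
  obtain k where "k \<ge> l" "block x k n \<in> L" using assms(3) unfolding right_recurrent_def by blast
  then show False using no_entries_left_closed[OF assms(1) e] l by blast
qed

text \<open>A language without entries contains every window far enough to the left, and
  disjointness allows this for one language only.\<close>

lemma unentered_unique:
  assumes "L \<in> \<L>" "L' \<in> \<L>" "N \<le> n" "entries L n = {}" "entries L' n = {}"
  shows "L = L'"
proof -
  obtain k k' where k: "block x k n \<in> L" "block x k' n \<in> L'"
    using occurs[OF assms(1)] occurs[OF assms(2)] by metis
  have "block x (min k k') n \<in> L" "block x (min k k') n \<in> L'"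
    using no_entries_left_closed assms k by (meson min.cobounded1 min.cobounded2)+
  then show ?thesis using disjoint assms by (metis length_block)
qed

lemma right_recurrent_not_left_closed:
  assumes "L \<in> \<L>" "N \<le> n" "right_recurrent x L"
  obtains k where "block x k n \<in> L" "block x (k - 1) n \<notin> L"
proof -
  obtain l where l: "block x l n \<notin> L" using leave[OF assms(1,2)] by blast
  obtain k where k: "k \<ge> l" "block x k n \<in> L"
    using assms(3) unfolding right_recurrent_def by blast
  have "\<exists>k. block x k n \<in> L \<and> block x (k - 1) n \<notin> L"
  proof (rule ccontr)
    assume *: "\<not> ?thesis"
    from k(1) have "block x l n \<in> L"
      by (induction l rule: int_le_induct) (use k(2) * in auto)
    with l show False ..
  qed
  then show thesis using that by blast
qed

lemma not_right_closed:
  assumes "L \<in> \<L>" "N \<le> n"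
  obtains k where "block x k n \<in> L" "block x (k + 1) n \<notin> L"
proof -
  obtain k where k: "block x k n \<in> L" using occurs[OF assms(1)] .
  obtain l where l: "l \<ge> k" "block x l n \<notin> L" using leave[OF assms] by blast
  have "\<exists>k. block x k n \<in> L \<and> block x (k + 1) n \<notin> L"
  proof (rule ccontr)
    assume *: "\<not> ?thesis"
    from l(1) have "block x l n \<in> L"
      by (induction l rule: int_ge_induct) (use k * in auto)
    with l show False by blast
  qed
  then show thesis using that by blast
qed

section \<open>Impossibility of minimal growth at all large levels\<close>

context
  fixes n\<^sub>0
  assumes n0: "N \<le> n\<^sub>0"
    and tight: "\<And>n. n\<^sub>0 \<le> n \<Longrightarrow> cx (Suc n) \<le> cx n + card \<L> + grow"
begin

text \<open>Every language has an exit, and tightness in \<open>count_exits\<close> leaves room for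
  only \<open>card \<L>\<close> exits in all.\<close>

lemma unique_exit:
  assumes "n\<^sub>0 \<le> n" "L \<in> \<L>" "u \<in> exits L n" "v \<in> exits L n"
  shows "u = v"
proof (rule ccontr)
  assume "u \<noteq> v"
  then have "card (exits L n) > 1"
    using assms finite_exits by (metis card_le_Suc0_iff_eq linorder_not_less One_nat_def)
  moreover have "1 \<le> card (exits M n)" if "M \<in> \<L>" for M
    using exits_nonempty[OF that, of n] finite_exits n0 assms(1) by (simp add: Suc_leI card_gt_0_iff)
  ultimately have "(\<Sum>L\<in>\<L>. 1) < (\<Sum>L\<in>\<L>. card (exits L n))"
    using finite_\<L> assms(2) by (intro sum_strict_mono_ex1) auto
  then show False using count_exits[of n] tight[of n] assms(1) n0 by simp
qed

text \<open>By \<open>count_special\<close>, a second extension would raise the growth by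
  one.\<close>

lemma unique_extension:
  assumes "n\<^sub>0 \<le> length w" "\<And>L. L \<in> \<L> \<Longrightarrow> w \<notin> L"
    "w @ [a] \<in> factors x" "w @ [b] \<in> factors x"
  shows "a = b"
proof (rule ccontr)
  assume "a \<noteq> b"
  moreover have "N \<le> length w" using assms(1) n0 by simp
  ultimately have "cx (length w) + grow + (\<Sum>L\<in>\<L>. card (exits L (length w))) < cx (Suc (length w))"
    "card \<L> \<le> (\<Sum>L\<in>\<L>. card (exits L (length w)))"
    using count_special[OF _ assms(2-4)] sum_exits_ge by blast+
  then show False using tight[OF assms(1)] by linarith
qed

text \<open>There are at most \<open>card \<L>\<close> entries in all and at most one language
  without entries. If \<open>L1\<close> and \<open>L2\<close> both had two or more entries, the sum
  would be at least \<open>card \<L> + 1\<close>.\<close>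

lemma exists_unique_entry:
  obtains L u where "L \<in> \<L>" "right_recurrent x L" "entries L n\<^sub>0 = {u}"
proof -
  obtain L1 L2 where L: "L1 \<in> \<L>" "L2 \<in> \<L>" "L1 \<noteq> L2" "right_recurrent x L1" "right_recurrent x L2"
    using two_recurrent by blast
  define Z where "Z = {L \<in> \<L>. entries L n\<^sub>0 = {}}"
  have "card Z \<le> 1" using unentered_unique[OF _ _ n0] finite_\<L>
    by (auto simp: Z_def card_le_Suc0_iff_eq)
  have ge: "1 \<le> card (entries M n\<^sub>0)" if "M \<in> {L1, L2}" for M
    using entries_nonempty[OF _ n0, of M] finite_entries that L by (auto simp: Suc_leI card_gt_0_iff)
  have "card (entries L1 n\<^sub>0) = 1 \<or> card (entries L2 n\<^sub>0) = 1"
  proof (rule ccontr)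
    assume c: "\<not> ?thesis"
    have "card \<L> + 2 = (\<Sum>L\<in>\<L>. 1 + of_bool (L \<in> {L1, L2}))"
    proof -
      have "(\<Sum>L\<in>\<L>. if L \<in> {L1, L2} then 1 else 0) = card (\<L> \<inter> {L1, L2})"
        using sum.inter_restrict[OF finite_\<L>, of "\<lambda>_. 1::nat" "{L1, L2}"] by simp
      also have "\<L> \<inter> {L1, L2} = {L1, L2}" using L by blast
      finally show ?thesis using L(3) by (simp only: sum.distrib of_bool_def) simp
    qed
    \<comment> \<open>The indicator of \<open>Z\<close> makes up for a language without entries, so
      that the sums can be compared term by term.\<close>
    also have "\<dots> \<le> (\<Sum>L\<in>\<L>. card (entries L n\<^sub>0) + of_bool (L \<in> Z))"
    proof (rule sum_mono)
      fix M assume M: "M \<in> \<L>"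
      show "1 + of_bool (M \<in> {L1, L2}) \<le> card (entries M n\<^sub>0) + of_bool (M \<in> Z)"
      proof (cases "M \<in> {L1, L2}")
        case True
        then show ?thesis using ge[OF True] c by auto
      next
        case False
        then show ?thesis using M finite_entries[of M n\<^sub>0] by (auto simp: Z_def Suc_leI card_gt_0_iff)
      qed
    qed
    also have "\<dots> = (\<Sum>L\<in>\<L>. card (entries L n\<^sub>0)) + card Z"
    proof -
      have "\<L> \<inter> Z = Z" by (auto simp: Z_def)
      then show ?thesis using finite_\<L> by (simp add: sum.distrib of_bool_def sum.If_cases Int_def)
    qed
    finally show False using count_entries[OF n0] tight[of n\<^sub>0] \<open>card Z \<le> 1\<close> by simp
  qed
  then obtain M where M: "M \<in> \<L>" "right_recurrent x M" "card (entries M n\<^sub>0) = 1"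
    using L by blast
  then obtain u where "entries M n\<^sub>0 = {u}" using card_1_singletonE by blast
  then show thesis using that M by blast
qed

text \<open>An entry at the next level that does not extend \<open>u\<close> would be the unique exit from \<open>L\<close> as
  well; as its tail lies in \<open>L\<close> again, \<open>L\<close> could never be left.\<close>

lemma unique_entry_Suc:
  assumes n: "n\<^sub>0 \<le> n" and L: "L \<in> \<L>" "right_recurrent x L" and u: "entries L n = {u}"
  obtains d where "entries L (Suc n) = {u @ [d]}" "\<And>a. u @ [a] \<in> factors x \<Longrightarrow> a = d"
proof -
  have Nn: "N \<le> n" using n n0 by simp
  have u': "u \<in> factors x" "length u = Suc n" "tl u \<in> L" "u \<notin> L"
    using u by (auto simp: entries_def level_def)
  have out: "u \<notin> M" if "M \<in> \<L>" for M
  proof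
    assume "u \<in> M"
    then have "tl u \<in> M" using ext_langD(4)[OF lang[OF that]] by blast
    then have "M = L" using disjoint[OF that L(1)] u' Nn by simp
    with \<open>u \<in> M\<close> u' show False by blast
  qed
  obtain d where d: "u @ [d] \<in> factors x"
    using ext_langE[OF ext_lang_factors u'(1)] by metis
  have uniq: "a = d" if "u @ [a] \<in> factors x" for a
    using unique_extension[of u a d] out that d u'(2) n by auto
  \<comment> \<open>At some position \<open>x\<close> moves from outside \<open>L\<close> into
    \<open>L\<close> at level \<open>n + 1\<close>. The word met there starts with an entry of level
    \<open>n\<close>, that is with \<open>u\<close>, and its last letter is \<open>d\<close>; so its
    tail, which lies in \<open>L\<close>, is \<open>tl (u @ [d])\<close>.\<close>
  have tl: "tl (u @ [d]) \<in> L"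
  proof (rule ccontr)
    assume c: "tl (u @ [d]) \<notin> L"
    obtain k where k: "block x k (Suc n) \<in> L" "block x (k - 1) (Suc n) \<notin> L"
      using right_recurrent_not_left_closed[OF L(1) _ L(2), of "Suc n"] Nn by auto
    have "block x k n \<in> L" using ext_langD(3)[OF lang[OF L(1)] k(1)] by simp
    then have "block x (k - 1) (Suc n) \<in> entries L n"
      using k(2) by (auto simp: entries_def level_def)
    then have "block x (k - 1) (Suc n) = u" using u by blast
    then have *: "block x (k - 1) (Suc (Suc n)) = u @ [x (k - 1 + int (Suc n))]"
      by (simp only: block_Suc)
    then have "block x (k - 1) (Suc (Suc n)) = u @ [d]" using uniq by (metis block_in_factors)
    then have "block x k (Suc n) = tl (u @ [d])" by (metis diff_add_cancel tl_block)
    then show False using c k(1) by simp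
  qed
  have "v = u @ [d]" if v: "v \<in> entries L (Suc n)" for v
  proof (cases "butlast v \<in> L")
    case False
    \<comment> \<open>In this case deleting the last letter leaves an entry of level
      \<open>n\<close>, which must be \<open>u\<close>.\<close>
    have "butlast (tl v) \<in> L" using v ext_langD(3)[OF lang[OF L(1)]] by (auto simp: entries_def)
    then have "butlast v \<in> entries L n"
      using v False ext_langD(3)[OF ext_lang_factors, of v x]
      by (auto simp: entries_def level_def butlast_tl)
    then have "butlast v = u" using u by blast
    moreover have "v \<noteq> []" "v \<in> factors x" using v by (auto simp: entries_def level_def)
    ultimately show ?thesis using uniq by (metis append_butlast_last_id)
  next
    case True
    then have vx: "v \<in> exits L (Suc n)" using v by (auto simp: entries_def exits_def)
    obtain k where k: "block x k (Suc n) \<in> L" "block x (k + 1) (Suc n) \<notin> L"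
      using not_right_closed[OF L(1), of "Suc n"] Nn by auto
    have "block x k (Suc (Suc n)) \<notin> L"
      using k(2) ext_langD(4)[OF lang[OF L(1)]] by (metis tl_block)
    then have "block x k (Suc (Suc n)) \<in> exits L (Suc n)"
      using k(1) by (auto simp: exits_def level_def)
    then have "block x k (Suc (Suc n)) = v" using unique_exit[of "Suc n" L] vx n L(1) by auto
    then have "tl v = block x (k + 1) (Suc n)" by auto
    then show ?thesis using v k(2) by (simp add: entries_def)
  qed
  moreover have "u @ [d] \<in> entries L (Suc n)"
    using d tl u' ext_langD(2)[OF lang[OF L(1)]] by (auto simp: entries_def level_def)
  ultimately have "entries L (Suc n) = {u @ [d]}" by blast
  then show thesis using uniq that by blast
qed

text \<open>The entry found at level \<open>n\<^sub>0\<close> occurs in \<open>x\<close> at some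
  position \<open>k\<close>. Inductively, the unique entry at every higher level is the longer block
  at the same \<open>k\<close>, so \<open>x\<close> stays in \<open>L\<close> from
  \<open>k + 1\<close> on, against \<open>leave\<close>.\<close>

lemma not_tight: False
proof -
  obtain L u where L: "L \<in> \<L>" "right_recurrent x L" and u: "entries L n\<^sub>0 = {u}"
    by (rule exists_unique_entry)
  have "u \<in> factors x" "length u = Suc n\<^sub>0" using u by (auto simp: entries_def level_def)
  then obtain k where k: "block x k (Suc n\<^sub>0) = u" by (metis factorsE)
  have all: "entries L n = {block x k (Suc n)}" if "n\<^sub>0 \<le> n" for n
    using that
  proof (induction n rule: dec_induct)
    case base then show ?case using u k by simp
  next
    case (step n)
    obtain d where d: "entries L (Suc n) = {block x k (Suc n) @ [d]}"
        "\<And>a. block x k (Suc n) @ [a] \<in> factors x \<Longrightarrow> a = d"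
      using unique_entry_Suc[OF step(1) L step(3)] by blast
    then show ?case by (metis block_Suc block_in_factors)
  qed
  obtain l where l: "l \<ge> k + 1" "block x l n\<^sub>0 \<notin> L" using leave[OF L(1) n0] by blast
  \<comment> \<open>With this length the block starting at \<open>k + 1\<close> ends exactly where
    the window of length \<open>n\<^sub>0\<close> at \<open>l\<close> ends.\<close>
  define m where "m = n\<^sub>0 + nat (l - k - 1)"
  have "block x k (Suc m) \<in> entries L m" using all[of m] by (simp add: m_def)
  then have "block x (k + 1) m \<in> L" by (simp add: entries_def)
  then have "block x l n\<^sub>0 \<in> L"
    using ext_lang_sub_block[OF lang[OF L(1)]] l(1) by (simp add: m_def)
  with l show False by blast
qed

end

theorem strict_growth: "\<exists>n\<ge>m. cx n + card \<L> + grow < cx (Suc n)"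
proof (rule ccontr)
  assume "\<not> ?thesis"
  then show False using not_tight[of "max m N"] by force
qed

end

section \<open>Subshifts and their languages\<close>

lemma topspace_full_shift: "topspace (full_shift A) = {x. range x \<subseteq> A}"
  by (auto simp: full_shift_def PiE_UNIV_domain)

lemma block_cong: "(\<And>l. k \<le> l \<Longrightarrow> l < k + int n \<Longrightarrow> x l = y l) \<Longrightarrow> block x k n = block y k n"
  by (simp add: block_def)

lemma block_eqD: "block x k n = block y k n \<Longrightarrow> k \<le> l \<Longrightarrow> l < k + int n \<Longrightarrow> x l = y l"
proof -
  assume *: "block x k n = block y k n" "k \<le> l" "l < k + int n"
  then have "block x k n ! nat (l - k) = block y k n ! nat (l - k)" by simp
  with *(2,3) show "x l = y l" by (simp add: nth_block nat_less_iff)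
qed

lemma block_shift: "block (shift m x) k n = block x (k + m) n"
  by (simp add: block_def shift_def algebra_simps)

lemma set_factors: "w \<in> factors x \<Longrightarrow> set w \<subseteq> range x"
  by (auto simp: factors_def block_def)

text \<open>Allowing an arbitrary property of the block, rather than one prescribed word, makes the
  complement a set of the same form, so that closedness follows as well.\<close>

lemma openin_cylinder: "openin (full_shift A) {x \<in> topspace (full_shift A). Q (block x k n)}"
  unfolding full_shift_def openin_product_topology_alt
proof
  fix x assume x: "x \<in> {x \<in> topspace (product_topology (\<lambda>_. discrete_topology A) UNIV). Q (block x k n)}"
  let ?U = "\<lambda>i. if k \<le> i \<and> i < k + int n then {x i} else A"
  have "y \<in> {x. Q (block x k n)}" if "y \<in> Pi\<^sub>E UNIV ?U" for y
  proof -
    have "y i = x i" if "k \<le> i" "i < k + int n" for i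
      using PiE_mem[OF \<open>y \<in> Pi\<^sub>E UNIV ?U\<close>, of i] that by simp
    then have "block y k n = block x k n" by (rule block_cong)
    then show ?thesis using x by simp
  qed
  moreover have "finite {i. ?U i \<noteq> A}"
    by (rule finite_subset[of _ "{k..<k + int n}"]) auto
  moreover have "?U i \<subseteq> A" for i using x by (auto simp: PiE_UNIV_domain)
  ultimately show "\<exists>U. finite {i \<in> UNIV. U i \<noteq> topspace (discrete_topology A)}
      \<and> (\<forall>i\<in>UNIV. openin (discrete_topology A) (U i)) \<and> x \<in> Pi\<^sub>E UNIV U
      \<and> Pi\<^sub>E UNIV U \<subseteq> {x \<in> topspace (product_topology (\<lambda>_. discrete_topology A) UNIV). Q (block x k n)}"
    using x by (intro exI[of _ ?U]) (fastforce simp: PiE_UNIV_domain split: if_splits)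
qed

lemma closedin_cylinder: "closedin (full_shift A) {x \<in> topspace (full_shift A). Q (block x k n)}"
proof -
  have "topspace (full_shift A) - {x \<in> topspace (full_shift A). Q (block x k n)}
      = {x \<in> topspace (full_shift A). \<not> Q (block x k n)}" by blast
  then show ?thesis using openin_cylinder[of A "\<lambda>w. \<not> Q w"] by (simp add: closedin_def)
qed

text \<open>A basic neighbourhood of \<open>z\<close> constrains finitely many coordinates, which
  lie in one window; a shift of \<open>x\<close> agrees with \<open>z\<close> on the window exactly
  when that word of \<open>z\<close> occurs in \<open>x\<close>. This translates orbit closures into
  languages.\<close>

lemma closure_of_orbit:
  assumes "range x \<subseteq> A"
  shows "full_shift A closure_of orbit x = {z. factors z \<subseteq> factors x}"
proof (intro set_eqI iffI)
  fix z assume z: "z \<in> full_shift A closure_of orbit x"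
  have "block z k n \<in> factors x" for k n
  proof -
    let ?T = "{y \<in> topspace (full_shift A). block y k n = block z k n}"
    have "z \<in> ?T" using z by (simp add: in_closure_of)
    moreover have "openin (full_shift A) ?T" by (rule openin_cylinder)
    ultimately have "\<exists>y. y \<in> orbit x \<and> y \<in> ?T"
      using in_closure_of[of z "full_shift A" "orbit x", THEN iffD1, OF z] by (elim conjE allE[of _ ?T]) simp
    then obtain y where "y \<in> orbit x" "block y k n = block z k n" by blast
    moreover then obtain m where "y = shift m x" by (auto simp: orbit_def)
    ultimately show ?thesis by (metis block_shift block_in_factors)
  qed
  then show "z \<in> {z. factors z \<subseteq> factors x}" by (auto simp: factors_def)
next
  fix z assume "z \<in> {z. factors z \<subseteq> factors x}"
  then have z: "block z k n \<in> factors x" for k n by auto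
  have "z k \<in> A" for k
    using z[of k 1] assms by (auto simp: factors_def block_def)
  then have zt: "z \<in> topspace (full_shift A)" by (auto simp: topspace_full_shift)
  show "z \<in> full_shift A closure_of orbit x" unfolding in_closure_of
  proof (intro conjI allI impI zt)
    fix T assume "z \<in> T \<and> openin (full_shift A) T"
    then obtain U where U: "finite {i. U i \<noteq> A}" "z \<in> Pi\<^sub>E UNIV U" "Pi\<^sub>E UNIV U \<subseteq> T"
      unfolding full_shift_def openin_product_topology_alt by fastforce
    \<comment> \<open>Inserting \<open>0\<close> keeps \<open>F\<close> nonempty, so that its
      minimum and maximum make sense.\<close>
    define F where "F = insert 0 {i. U i \<noteq> A}"
    have F: "finite F" "F \<noteq> {}" using U(1) by (auto simp: F_def)
    define k where "k = Min F"
    define n where "n = nat (Max F - k + 1)"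
    obtain l where l: "block x l n = block z k n"
      using factorsE[OF z[of k n]] by (metis length_block)
    have "shift (l - k) x \<in> Pi\<^sub>E UNIV U"
      unfolding PiE_UNIV_domain
    proof (intro CollectI PiE_I Pi_I)
      fix i :: int
      show "shift (l - k) x i \<in> U i"
      proof (cases "i \<in> F")
        case True
        then have i: "k \<le> i" "i \<le> Max F" using F by (auto simp: k_def)
        have "block (shift (l - k) x) k n = block z k n" using l by (simp add: block_shift)
        then have "shift (l - k) x i = z i"
          by (rule block_eqD) (use i in \<open>auto simp: n_def\<close>)
        then show ?thesis using U(2) by auto
      next
        case False
        then have "U i = A" by (auto simp: F_def)
        then show ?thesis using assms by (auto simp: shift_def)
      qed
    qed
    then show "\<exists>y. y \<in> orbit x \<and> y \<in> T" using U(3) by (auto simp: orbit_def)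
  qed
qed

lemma shift_shift: "shift m (shift n x) = shift (m + n) x"
  by (simp add: shift_def algebra_simps)

lemma shift_0 [simp]: "shift 0 x = x"
  by (simp add: shift_def)

lemma subshift_range: "subshift A X \<Longrightarrow> x \<in> X \<Longrightarrow> range x \<subseteq> A"
  using closedin_subset[of "full_shift A" X] by (auto simp: subshift_def topspace_full_shift)

lemma subshift_shift:
  assumes "subshift A X" "x \<in> X" shows "shift n x \<in> X"
proof -
  have X: "shift 1 ` X = X" using assms(1) by (simp add: subshift_def)
  have minus: "shift (-1) y \<in> X" if y: "y \<in> X" for y
  proof -
    have "y \<in> shift 1 ` X" using X y by simp
    then obtain y' where "y' \<in> X" "y = shift 1 y'" by blast
    then show ?thesis by (simp add: shift_shift)
  qed
  show ?thesis
  proof (induction n rule: int_induct[where k = 0])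
    case (step1 i)
    then have "shift 1 (shift i x) \<in> X" using X by blast
    then show ?case by (simp add: shift_shift add.commute)
  next
    case (step2 i)
    then show ?case using minus[of "shift i x"] by (simp add: shift_shift)
  qed (use assms in simp)
qed

section \<open>Minimal subshifts and their languages\<close>

lemma minimal_subshift_eq:
  assumes "minimal_subshift A M" "m \<in> M"
  shows "M = {z. factors z \<subseteq> factors m}"
proof -
  have "subshift A M" "M = full_shift A closure_of orbit m"
    using assms by (simp_all add: minimal_subshift_def)
  then show ?thesis using closure_of_orbit[OF subshift_range[OF _ assms(2)]] by simp
qed

lemma minimal_subshift_factors_eq:
  assumes "minimal_subshift A M" "m \<in> M" "z \<in> M"
  shows "factors z = factors m"
  using minimal_subshift_eq[OF assms(1,2)] minimal_subshift_eq[OF assms(1,3)] assms(2,3) by blast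

lemma minimal_lang_eq:
  assumes "minimal_subshift A M" "m \<in> M"
  shows "\<Union>(factors ` M) = factors m"
  using assms(2) minimal_subshift_factors_eq[OF assms] by blast

text \<open>The points whose central block of length \<open>2 * n\<close> lies in \<open>P\<close>
  form a decreasing sequence of nonempty closed sets, and the full shift is compact.\<close>

lemma konig:
  assumes A: "finite A" and PA: "\<And>w. w \<in> P \<Longrightarrow> set w \<subseteq> A"
    and fac: "\<And>u v w. u @ v @ w \<in> P \<Longrightarrow> v \<in> P"
    and long: "\<And>n. \<exists>w\<in>P. n \<le> length w"
  obtains z where "factors z \<subseteq> P"
proof -
  have take: "take n w \<in> P" if "w \<in> P" for n w using fac[of "[]" "take n w" "drop n w"] that by simp
  have len: "\<exists>w\<in>P. length w = n" for n
    using long[of n] take by (metis length_take min.absorb2)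
  define C where "C n = {z \<in> topspace (full_shift A). block z (- int n) (2 * n) \<in> P}" for n
  have sub: "block z k n \<in> P" if "block z l m \<in> P" "l \<le> k" "k + int n \<le> l + int m" for z k n l m
  proof -
    define a where "a = nat (k - l)"
    define b where "b = m - a - n"
    have "m = a + (n + b)" "k = l + int a" using that by (auto simp: a_def b_def)
    then show ?thesis using that(1) fac by (metis block_add)
  qed
  have "(\<Inter>n. C n) \<noteq> {}"
  proof (rule compact_space_imp_nest[of "full_shift A"])
    show "compact_space (full_shift A)"
      unfolding full_shift_def compact_space_product_topology
      using A by (simp add: compact_space_discrete_topology)
    show "closedin (full_shift A) (C n)" for n unfolding C_def by (rule closedin_cylinder)
    show "C n \<noteq> {}" for n
    proof -
      obtain w where w: "w \<in> P" "length w = 2 * n" using len by blast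
      \<comment> \<open>Outside the window any letter of \<open>A\<close> will do; a word of length
        one in \<open>P\<close> supplies it.\<close>
      obtain v where v: "v \<in> P" "length v = 1" using len by blast
      define z where "z k = (if - int n \<le> k \<and> k < int n then w ! nat (k + int n) else hd v)" for k
      have "block z (- int n) (2 * n) = w"
        using w by (intro nth_equalityI) (auto simp: nth_block z_def)
      moreover have "z k \<in> A" for k
      proof -
        have "hd v \<in> set v" using v(2) by (cases v) auto
        moreover have "w ! nat (k + int n) \<in> set w" if "- int n \<le> k" "k < int n"
          using that w(2) by (intro nth_mem) auto
        ultimately show ?thesis using PA[OF v(1)] PA[OF w(1)] by (auto simp: z_def)
      qed
      ultimately have "z \<in> C n" using w(1) unfolding C_def topspace_full_shift by blast
      then show ?thesis by blast
    qed
    show "decseq C" unfolding decseq_def C_def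
      by (auto elim!: sub)
  qed
  then obtain z where z: "\<And>n. z \<in> C n" by blast
  have "block z k n \<in> P" for k n
  proof -
    have "block z (- int (nat \<bar>k\<bar> + n)) (2 * (nat \<bar>k\<bar> + n)) \<in> P"
      using z[of "nat \<bar>k\<bar> + n"] unfolding C_def by blast
    then show ?thesis by (rule sub) auto
  qed
  then show thesis by (intro that[of z]) (auto simp: factors_def)
qed

lemma words_eq: "words X n = {block x k n | x k. x \<in> X}"
  by (simp add: words_def block_def)

lemma words_orbit_closure:
  assumes "x \<in> X" "X = {z. factors z \<subseteq> factors x}"
  shows "words X n = level (factors x) n"
proof
  show "words X n \<subseteq> level (factors x) n"
    using assms(2) by (auto simp: words_eq level_def dest: subsetD[OF _ block_in_factors])
  show "level (factors x) n \<subseteq> words X n"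
    using assms(1) by (auto simp: words_eq level_factors)
qed

text \<open>The argument of Morse and Hedlund: if the number of words does not grow from
  \<open>n\<close> to \<open>n + 1\<close>, a word of length \<open>n\<close> determines the letters
  on both sides of it, hence a whole point of \<open>M\<close>, and \<open>M\<close> is
  finite.\<close>

lemma infinite_minimal_strictly_growing:
  assumes M: "minimal_subshift A M" "m \<in> M" and inf: "infinite M"
  shows "strictly_growing (factors m)"
  unfolding strictly_growing_def
proof (rule allI, rule ccontr)
  fix n assume c: "\<not> card (level (factors m) n) < card (level (factors m) (Suc n))"
  have "subshift A M" using M(1) by (simp add: minimal_subshift_def)
  then have "range m \<subseteq> A" "finite A"
    using subshift_range[OF _ M(2)] by (simp_all add: subshift_def)
  then have fin: "finite (level (factors m) n)" for n
    using finite_level_factors finite_subset by blast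
  let ?Q = "level (factors m) (Suc n)" and ?P = "level (factors m) n"
  have inj: "inj_on f ?Q" if "f ` ?Q = ?P" for f :: "'a list \<Rightarrow> 'a list"
    using c fin card_image_le[OF fin, of f "Suc n"] that
    by (intro eq_card_imp_inj_on) auto
  have inj1: "inj_on butlast ?Q" and inj2: "inj_on tl ?Q"
    using inj butlast_level tl_level ext_lang_factors by blast+
  have *: "block z k l \<in> level (factors m) l" if "z \<in> M" for z k l
    using block_in_factors[of z k l] minimal_subshift_factors_eq[OF M that] by (simp add: level_def)
  have "inj_on (\<lambda>z. block z 0 n) M"
  proof (rule inj_onI)
    fix z z' assume z: "z \<in> M" "z' \<in> M" "block z 0 n = block z' 0 n"
    have up: "block z k (Suc n) = block z' k (Suc n)" if "block z k n = block z' k n" for k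
      using inj_onD[OF inj1 _ *[OF z(1)] *[OF z(2)]] that by simp
    have down: "block z k (Suc n) = block z' k (Suc n)" if "block z (k + 1) n = block z' (k + 1) n" for k
      using inj_onD[OF inj2 _ *[OF z(1)] *[OF z(2)]] that by simp
    have eq: "block z k n = block z' k n" for k
    proof (induction k rule: int_induct[where k = 0])
      case base then show ?case by (rule z(3))
    next
      case (step1 i) then show ?case using up[of i] by (metis tl_block)
    next
      case (step2 i) then show ?case using down[of "i - 1"] by (metis butlast_block diff_add_cancel)
    qed
    show "z = z'"
    proof
      fix k show "z k = z' k" using block_eqD[OF up[OF eq], of k k] by simp
    qed
  qed
  moreover have "(\<lambda>z. block z 0 n) ` M \<subseteq> ?P" using * by blast
  ultimately show False using inf fin finite_subset inj_on_finite by blast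
qed

section \<open>Reversal and one-sided recurrence\<close>

lemma block_reverse: "block (\<lambda>k. x (- k)) k n = rev (block x (1 - k - int n) n)"
  by (rule nth_equalityI) (auto simp: nth_block rev_nth algebra_simps of_nat_diff)

lemma factors_reverse: "factors (\<lambda>k. x (- k)) = rev ` factors x"
proof -
  have "rev (block x k n) = block (\<lambda>k. x (- k)) (1 - k - int n) n" for k n
    by (simp add: block_reverse)
  then have "rev ` factors x \<subseteq> factors (\<lambda>k. x (- k))"
    by (auto simp: factors_def)
  moreover have "factors (\<lambda>k. x (- k)) \<subseteq> rev ` factors x"
    by (auto simp: factors_def block_reverse)
  ultimately show ?thesis by blast
qed

lemma level_reverse: "level (rev ` L) n = rev ` level L n"
  by (auto simp: level_def)

lemma card_level_reverse: "card (level (rev ` L) n) = card (level L n)"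
  unfolding level_reverse by (rule card_image) simp

lemma mem_rev_image: "w \<in> rev ` L \<longleftrightarrow> rev w \<in> L"
  by (metis image_iff rev_rev_ident)

lemma ext_lang_reverse: "ext_lang L \<Longrightarrow> ext_lang (rev ` L)"
  unfolding ext_lang_def Ball_def mem_rev_image by auto

lemma inj_on_minimal_lang:
  assumes "\<And>M. M \<in> \<M> \<Longrightarrow> minimal_subshift A M"
  shows "inj_on (\<lambda>M. \<Union>(factors ` M)) \<M>"
proof (rule inj_onI)
  fix M M' assume M: "M \<in> \<M>" "M' \<in> \<M>" "\<Union>(factors ` M) = \<Union>(factors ` M')"
  have "M \<noteq> {}" "M' \<noteq> {}" using assms[OF M(1)] assms[OF M(2)] by (simp_all add: minimal_subshift_def)
  then obtain m m' where m: "m \<in> M" "m' \<in> M'" by blast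
  have "\<Union>(factors ` M) = factors m" "\<Union>(factors ` M') = factors m'"
    using minimal_lang_eq[OF assms[OF M(1)] m(1)] minimal_lang_eq[OF assms[OF M(2)] m(2)] by blast+
  then show "M = M'"
    using minimal_subshift_eq[OF assms[OF M(1)] m(1)] minimal_subshift_eq[OF assms[OF M(2)] m(2)] M(3)
    by simp
qed

text \<open>Otherwise words of \<open>L\<close> of some length do not occur far to the right, and
  words of some length do not occur far to the left; but arbitrarily long words of \<open>L\<close>
  occur in \<open>x\<close>, and one of them must reach too far on one side.\<close>

lemma ext_lang_recurrent:
  assumes L: "ext_lang L" "L \<subseteq> factors x"
  shows "right_recurrent x L \<or> right_recurrent (\<lambda>k. x (- k)) (rev ` L)"
proof (rule ccontr)
  assume "\<not> ?thesis"
  then obtain n K n' K' where K: "\<And>k. k \<ge> K \<Longrightarrow> block x k n \<notin> L"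
      and K': "\<And>k. k \<ge> K' \<Longrightarrow> block (\<lambda>k. x (- k)) k n' \<notin> rev ` L"
    unfolding right_recurrent_def by blast
  \<comment> \<open>Long enough that an occurrence contains a factor of length \<open>n\<close> at
    or beyond \<open>K\<close>, unless it starts so far to the left that its prefix of length
    \<open>n'\<close> contradicts \<open>K'\<close>.\<close>
  define m where "m = n + n' + nat (\<bar>K\<bar> + \<bar>K'\<bar>)"
  obtain w where "w \<in> L" "length w = m"
    using ext_lang_level_nonempty[OF L(1), of m] by (auto simp: level_def)
  then obtain k where k: "block x k m \<in> L" using L(2) by (metis factorsE subsetD)
  show False
  proof (cases "k + int n' \<le> 1 - K'")
    case True
    have "block x k n' \<in> L" by (rule ext_lang_sub_block[OF L(1) k]) (auto simp: m_def)
    moreover have "block (\<lambda>k. x (- k)) (1 - k - int n') n' = rev (block x k n')"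
      by (simp add: block_reverse)
    ultimately show False using K'[of "1 - k - int n'"] True by (simp add: mem_rev_image)
  next
    case False
    have "block x (max k K) n \<in> L"
      by (rule ext_lang_sub_block[OF L(1) k]) (use False in \<open>auto simp: m_def\<close>)
    then show False using K[of "max k K"] by simp
  qed
qed

lemma (in visited_languages) complexity_growth:
  assumes "\<And>n. cx n = complexity X n" "card \<L> = j" "i \<le> grow"
  shows "(\<forall>n\<ge>N. complexity X n + (j + i) \<le> complexity X (Suc n))
       \<and> (\<forall>m. \<exists>n\<ge>m. complexity X n + (j + i) < complexity X (Suc n))"
proof (intro conjI allI impI)
  fix n assume "N \<le> n"
  then show "complexity X n + (j + i) \<le> complexity X (Suc n)"
    using growth[of n] assms by simp
next
  fix m
  obtain n where "n \<ge> m" "cx n + card \<L> + grow < cx (Suc n)" using strict_growth by blast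
  then show "\<exists>n\<ge>m. complexity X n + (j + i) < complexity X (Suc n)"
    using assms by (intro exI[of _ n]) simp
qed

lemma obtain_two_of_card:
  assumes "finite S" "1 < card S" obtains a b where "a \<in> S" "b \<in> S" "a \<noteq> b"
  using assms card_le_Suc0_iff_eq[OF assms(1)] by (metis One_nat_def not_less)

text \<open>The languages of the minimal subsystems satisfy \<open>visited_languages\<close> for a
  point with dense orbit or for its reversal. The first conjunct is used again for sharpness, to
  pass from the lengths of visits to all lengths.\<close>

theorem transitive_growth:
  fixes A :: "'a set"
  assumes X: "transitive_subshift A X" and j: "card (minimal_subsystems A X) = j" "j \<ge> 3"
    and i: "card {Y \<in> minimal_subsystems A X. infinite Y} = i"
  shows "\<exists>N. (\<forall>n\<ge>N. complexity X n + (j + i) \<le> complexity X (Suc n))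
       \<and> (\<forall>m. \<exists>n\<ge>m. complexity X n + (j + i) < complexity X (Suc n))"
proof -
  have subX: "subshift A X" using X by (simp add: transitive_subshift_def)
  obtain x where x: "x \<in> X" "X = full_shift A closure_of orbit x"
    using X by (auto simp: transitive_subshift_def)
  have rx: "range x \<subseteq> A" by (rule subshift_range[OF subX x(1)])
  have finA: "finite A" using subX by (simp add: subshift_def)
  have Xeq: "X = {z. factors z \<subseteq> factors x}" using x(2) closure_of_orbit[OF rx] by simp
  define \<M> where "\<M> = minimal_subsystems A X"
  define lg :: "(int \<Rightarrow> 'a) set \<Rightarrow> 'a list set" where "lg M = \<Union>(factors ` M)" for M
  define \<L> where "\<L> = lg ` \<M>"
  have M: "minimal_subshift A M" "M \<subseteq> X" if "M \<in> \<M>" for M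
    using that by (auto simp: \<M>_def minimal_subsystems_def)
  have inj: "inj_on lg \<M>" unfolding lg_def by (rule inj_on_minimal_lang[OF M(1)])
  have fin\<M>: "finite \<M>" using j card.infinite by (fastforce simp: \<M>_def)
  have fin\<L>: "finite \<L>" using fin\<M> by (simp add: \<L>_def)
  have card\<L>: "card \<L> = j" using card_image[OF inj] j by (simp add: \<L>_def \<M>_def)
  have pt: "\<exists>M\<in>\<M>. \<exists>m\<in>M. L = lg M \<and> L = factors m" if L: "L \<in> \<L>" for L
  proof -
    obtain M' where M': "M' \<in> \<M>" "L = lg M'" using L by (auto simp: \<L>_def)
    then obtain m where "m \<in> M'" using M(1) unfolding minimal_subshift_def by blast
    moreover have "lg M' = factors m"
      using minimal_lang_eq[OF M(1)[OF M'(1)] calculation] by (simp add: lg_def)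
    ultimately show ?thesis using M' by blast
  qed
  have lang: "ext_lang L" if "L \<in> \<L>" for L
    using pt[OF that] ext_lang_factors by metis
  have visited: "L \<subseteq> factors x" if "L \<in> \<L>" for L
    using pt[OF that] M(2) Xeq by blast
  \<comment> \<open>If two languages shared arbitrarily long words, \<open>konig\<close> would
    produce a point of both subsystems, and their languages would coincide.\<close>
  have "\<exists>N. \<forall>w. w \<in> fst p \<longrightarrow> w \<in> snd p \<longrightarrow> N \<le> length w \<longrightarrow> fst p = snd p"
    if p: "p \<in> \<L> \<times> \<L>" for p
  proof (rule ccontr)
    assume *: "\<not> ?thesis"
    obtain M1 m1 where 1: "M1 \<in> \<M>" "m1 \<in> M1" "fst p = factors m1"
      using pt[of "fst p"] p by (auto simp: mem_Times_iff)
    obtain M2 m2 where 2: "M2 \<in> \<M>" "m2 \<in> M2" "snd p = factors m2"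
      using pt[of "snd p"] p by (auto simp: mem_Times_iff)
    obtain z where z: "factors z \<subseteq> fst p \<inter> snd p"
    proof (rule konig[OF finA, of "fst p \<inter> snd p"])
      show "\<exists>w\<in>fst p \<inter> snd p. n \<le> length w" for n using * by blast
      show "set w \<subseteq> A" if "w \<in> fst p \<inter> snd p" for w
      proof -
        have "w \<in> factors x" using that visited[of "fst p"] p by (auto simp: mem_Times_iff)
        then show ?thesis using rx set_factors by fast
      qed
      show "v \<in> fst p \<inter> snd p" if "u @ v @ w \<in> fst p \<inter> snd p" for u v w
        using that ext_langD(1)[OF lang[of "fst p"], of u v w]
          ext_langD(1)[OF lang[of "snd p"], of u v w] p by (auto simp: mem_Times_iff)
    qed
    have "z \<in> M1" "z \<in> M2"
      using minimal_subshift_eq[OF M(1)[OF 1(1)] 1(2)] minimal_subshift_eq[OF M(1)[OF 2(1)] 2(2)]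
        z 1(3) 2(3) by auto
    then have "fst p = factors z" "snd p = factors z"
      using minimal_subshift_factors_eq M(1) 1 2 by metis+
    then show False using * by auto
  qed
  then obtain f where f: "\<And>p w. p \<in> \<L> \<times> \<L> \<Longrightarrow> w \<in> fst p \<Longrightarrow> w \<in> snd p \<Longrightarrow> f p \<le> length w \<Longrightarrow> fst p = snd p"
    by metis
  define N where "N = sum f (\<L> \<times> \<L>)"
  have disj: "L = L'" if "L \<in> \<L>" "L' \<in> \<L>" "w \<in> L" "w \<in> L'" "N \<le> length w" for L L' w
  proof -
    have p: "(L, L') \<in> \<L> \<times> \<L>" using that by simp
    have "f (L, L') \<le> N" unfolding N_def
      by (rule member_le_sum[OF p]) (use fin\<L> in auto)
    then show ?thesis using f[OF p, of w] that by simp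
  qed
  let ?y = "\<lambda>k. x (- k)"
  define R where "R = {L \<in> \<L>. right_recurrent x L}"
  define S where "S = {L \<in> \<L>. right_recurrent ?y (rev ` L)}"
  have RS: "\<L> = R \<union> S" using ext_lang_recurrent[OF lang visited] by (auto simp: R_def S_def)
  have finRS: "finite R" "finite S" using fin\<L> by (auto simp: R_def S_def)
  have finr: "finite (range x)" using rx finA finite_subset by blast
  have cx: "complexity X n = card (level (factors x) n)" for n
    unfolding complexity_def by (simp add: words_orbit_closure[OF x(1) Xeq])
  have grow: "i \<le> card {L \<in> \<L>. strictly_growing L}"
  proof -
    have "lg ` {Y \<in> \<M>. infinite Y} \<subseteq> {L \<in> \<L>. strictly_growing L}"
    proof
      fix L assume "L \<in> lg ` {Y \<in> \<M>. infinite Y}"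
      then obtain Y where Y: "Y \<in> \<M>" "infinite Y" "L = lg Y" by blast
      then obtain m where m: "m \<in> Y" by fastforce
      have "L = factors m" using Y(3) minimal_lang_eq[OF M(1)[OF Y(1)] m] by (simp add: lg_def)
      then show "L \<in> {L \<in> \<L>. strictly_growing L}"
        using infinite_minimal_strictly_growing[OF M(1)[OF Y(1)] m Y(2)] Y by (auto simp: \<L>_def)
    qed
    then have "card (lg ` {Y \<in> \<M>. infinite Y}) \<le> card {L \<in> \<L>. strictly_growing L}"
      using fin\<L> by (intro card_mono) auto
    moreover have "card (lg ` {Y \<in> \<M>. infinite Y}) = i"
      using i inj by (subst card_image) (auto simp: \<M>_def intro: inj_on_subset)
    ultimately show ?thesis by simp
  qed
  \<comment> \<open>At least three languages each recur on some side, so one side has two of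
    them.\<close>
  have "1 < card R \<or> 1 < card S"
  proof -
    have "j \<le> card R + card S" using card_Un_le[of R S] RS card\<L> by simp
    then show ?thesis using j(2) by linarith
  qed
  then show ?thesis
  proof
    assume "1 < card R"
    then obtain L L' where "L \<in> R" "L' \<in> R" "L \<noteq> L'" using obtain_two_of_card[OF finRS(1)] by blast
    then have "\<exists>L\<in>\<L>. \<exists>L'\<in>\<L>. L \<noteq> L' \<and> right_recurrent x L \<and> right_recurrent x L'"
      unfolding R_def by blast
    then interpret visited_languages x \<L> N
      using finr fin\<L> lang visited disj by unfold_locales
    show ?thesis using complexity_growth[of X j i] cx card\<L> grow by (auto simp: cx_def grow_def)
  next
    assume "1 < card S"
    then obtain L L' where LL: "L \<in> S" "L' \<in> S" "L \<noteq> L'" using obtain_two_of_card[OF finRS(2)] by blast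
    have injr: "inj_on ((`) rev) \<L>" by (simp add: inj_on_def inj_image_eq_iff)
    have "range ?y \<subseteq> range x" by auto
    then have finy: "finite (range ?y)" using finr finite_subset by blast
    interpret visited_languages ?y "(`) rev ` \<L>" N
    proof
      show "finite (range ?y)" by (rule finy)
      show "finite ((`) rev ` \<L>)" using fin\<L> by simp
      show "ext_lang K" if "K \<in> (`) rev ` \<L>" for K using that lang ext_lang_reverse by blast
      show "K \<subseteq> factors ?y" if "K \<in> (`) rev ` \<L>" for K
        using that visited unfolding factors_reverse by blast
      show "K = K'" if K: "K \<in> (`) rev ` \<L>" "K' \<in> (`) rev ` \<L>" "w \<in> K" "w \<in> K'" "N \<le> length w" for K K' w
      proof -
        obtain L L' where "L \<in> \<L>" "L' \<in> \<L>" "K = rev ` L" "K' = rev ` L'" using K(1,2) by blast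
        then show ?thesis using K(3-5) disj[of L L' "rev w"] by (simp add: mem_rev_image)
      qed
      show "\<exists>K\<in>(`) rev ` \<L>. \<exists>K'\<in>(`) rev ` \<L>. K \<noteq> K' \<and> right_recurrent ?y K \<and> right_recurrent ?y K'"
      proof -
        have "rev ` L \<noteq> rev ` L'" using LL(3) by (simp add: inj_image_eq_iff)
        moreover have "L \<in> \<L>" "L' \<in> \<L>" "right_recurrent ?y (rev ` L)" "right_recurrent ?y (rev ` L')"
          using LL(1,2) by (simp_all add: S_def)
        ultimately show ?thesis by (intro bexI[of _ "rev ` L"] bexI[of _ "rev ` L'"]) simp_all
      qed
    qed
    have "{K \<in> (`) rev ` \<L>. strictly_growing K} = (`) rev ` {L \<in> \<L>. strictly_growing L}"
      by (auto simp: strictly_growing_def card_level_reverse)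
    then have "grow = card {L \<in> \<L>. strictly_growing L}"
      unfolding grow_def using injr by (simp add: card_image inj_on_def)
    moreover have "cx n = complexity X n" for n
      by (simp add: cx_def cx factors_reverse card_level_reverse)
    ultimately show ?thesis
      using complexity_growth[of X j i] card\<L> grow card_image[OF injr] by (intro exI[of _ N]) simp
  qed
qed

section \<open>The Fibonacci language\<close>

fun fibw :: "nat \<Rightarrow> nat list" where
  "fibw 0 = [1]"
| "fibw (Suc 0) = [0]"
| "fibw (Suc (Suc n)) = fibw (Suc n) @ fibw n"

text \<open>Even Fibonacci words are nested both as prefixes and as suffixes, whereas words of
  different parity end in different letters. The index starts at 2 because
  \<open>fibw 0 = [1]\<close> is not a prefix of the others.\<close>

definition evenw :: "nat \<Rightarrow> nat list" where
  "evenw k = fibw (2 * k + 2)"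

definition fib_lang :: "nat list set" where
  "fib_lang = {v. \<exists>k. sublist v (evenw k)}"

lemma fibw_nonempty [simp]: "fibw n \<noteq> []"
  by (induction n rule: fibw.induct) auto

lemma set_fibw: "set (fibw n) \<subseteq> {0, 1}"
  by (induction n rule: fibw.induct) auto

text \<open>Each step of the induction prepends \<open>fibw (n + 1)\<close> to the common part
  \<open>z\<close> and exchanges \<open>a\<close> and \<open>b\<close>. This common part later
  supplies right special words and controls the windows of products of blocks.\<close>

lemma fibw_near_commute:
  "\<exists>z a b. a \<noteq> b \<and> fibw (Suc n) @ fibw n = z @ [a, b] \<and> fibw n @ fibw (Suc n) = z @ [b, a]"
proof (induction n)
  case 0
  then show ?case by (intro exI[of _ "[]"] exI[of _ 0] exI[of _ 1]) simp
next
  case (Suc n)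
  then obtain z a b where z: "a \<noteq> b" "fibw (Suc n) @ fibw n = z @ [a, b]" "fibw n @ fibw (Suc n) = z @ [b, a]"
    by blast
  have "fibw (Suc (Suc n)) @ fibw (Suc n) = (fibw (Suc n) @ z) @ [b, a]" using z(3) by simp
  moreover have "fibw (Suc n) @ fibw (Suc (Suc n)) = (fibw (Suc n) @ z) @ [a, b]" using z(2) by simp
  ultimately show ?case using z(1)[symmetric] by blast
qed

lemma evenw_Suc: "evenw (Suc k) = evenw k @ fibw (2 * k + 1) @ evenw k"
  by (simp add: evenw_def)

lemma length_evenw_less: "length (evenw k) < length (evenw (Suc k))"
  using fibw_nonempty[of "2 * k + 1"] unfolding evenw_Suc by (simp del: fibw_nonempty)

lemma evenw_nonempty [simp]: "evenw k \<noteq> []"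
  by (simp add: evenw_def)

lemma strict_mono_length_evenw: "strict_mono (\<lambda>k. length (evenw k))"
  by (simp add: strict_mono_Suc_iff length_evenw_less)

lemma evenw_mono:
  assumes "k \<le> l" shows "prefix (evenw k) (evenw l)" "suffix (evenw k) (evenw l)"
  using assms
proof (induction l rule: dec_induct)
  case (step l)
  {
    case 1
    then show ?case using step(3) unfolding evenw_Suc by (metis prefix_prefix step.hyps(1))
  next
    case 2
    then show ?case using step(4) unfolding evenw_Suc by (metis append_assoc suffix_appendI step.hyps(1))
  }
qed auto

lemma sublist_evenw_mono: "sublist v (evenw k) \<Longrightarrow> k \<le> l \<Longrightarrow> sublist v (evenw l)"
  using evenw_mono(1) prefix_imp_sublist sublist_order.order_trans by metis

lemma evenw_in_fib_lang: "evenw k \<in> fib_lang"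
  by (auto simp: fib_lang_def)

text \<open>A word of odd index is a prefix of the next one, so building \<open>fib_lang\<close>
  from even words loses nothing.\<close>

lemma fibw_in_fib_lang: "sublist v (fibw m) \<Longrightarrow> v \<in> fib_lang"
proof -
  assume v: "sublist v (fibw m)"
  have "sublist (fibw m) (fibw (2 * m + 2))"
  proof (cases "even m")
    case True
    then obtain k where m: "m = 2 * k" by blast
    have "suffix (fibw m) (evenw k)" unfolding evenw_def m by (simp add: suffix_def)
    then have "sublist (fibw m) (evenw k)" by blast
    then show ?thesis using sublist_evenw_mono[of "fibw m" k m] by (simp add: evenw_def m)
  next
    case False
    then obtain k where m: "m = 2 * k + 1" using oddE by blast
    have "prefix (fibw m) (evenw k)" unfolding evenw_def m by (simp add: prefix_def)
    then have "sublist (fibw m) (evenw k)" by blast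
    then show ?thesis using sublist_evenw_mono[of "fibw m" k m] by (simp add: evenw_def m)
  qed
  then show "v \<in> fib_lang" using v sublist_order.order_trans unfolding fib_lang_def evenw_def by blast
qed

text \<open>\<open>evenw k\<close> is a proper prefix and a proper suffix of
  \<open>evenw (Suc k)\<close>: a factor extends to the right in the first copy and to the left in
  the last one.\<close>

lemma ext_lang_fib_lang: "ext_lang fib_lang"
  unfolding ext_lang_def
proof (intro conjI allI impI ballI)
  show "[] \<in> fib_lang" by (auto simp: fib_lang_def)
next
  fix u v w assume "u @ v @ w \<in> fib_lang"
  then show "v \<in> fib_lang"
    unfolding fib_lang_def using sublist_order.order_trans sublist_append_leftI sublist_append_rightI by blast
next
  fix w assume "w \<in> fib_lang"
  then obtain k u v where k: "evenw k = u @ w @ v" by (auto simp: fib_lang_def sublist_def)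
  obtain c cs where "v @ fibw (2 * k + 1) @ evenw k = c # cs" by (cases "v @ fibw (2 * k + 1) @ evenw k") auto
  then have "evenw (Suc k) = u @ (w @ [c]) @ cs" unfolding evenw_Suc using k by simp
  then show "\<exists>a. w @ [a] \<in> fib_lang" unfolding fib_lang_def sublist_def by blast
next
  fix w assume "w \<in> fib_lang"
  then obtain k u v where k: "evenw k = u @ w @ v" by (auto simp: fib_lang_def sublist_def)
  obtain c cs where "evenw k @ fibw (2 * k + 1) @ u = cs @ [c]"
    by (cases "evenw k @ fibw (2 * k + 1) @ u" rule: rev_cases) auto
  then have "evenw (Suc k) = cs @ (c # w) @ v" unfolding evenw_Suc using k
    by (metis append.assoc append_Cons append_Nil)
  then show "\<exists>a. a # w \<in> fib_lang" unfolding fib_lang_def sublist_def by blast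
qed

lemma fibw_blocks:
  assumes "m \<le> M" shows "\<exists>bs. set bs \<subseteq> {fibw m, fibw (Suc m)} \<and> fibw M = concat bs"
  using assms
proof (induction M rule: less_induct)
  case (less M)
  consider "M = m" | "M = Suc m" | "M \<ge> Suc (Suc m)" using less.prems by linarith
  then show ?case
  proof cases
    case 1 then show ?thesis by (intro exI[of _ "[fibw m]"]) simp
  next
    case 2 then show ?thesis by (intro exI[of _ "[fibw (Suc m)]"]) simp
  next
    case 3
    then obtain M' where M': "M = Suc (Suc M')" "m \<le> M'" by (metis Suc_le_D Suc_le_mono)
    then obtain bs bs' where "set bs \<subseteq> {fibw m, fibw (Suc m)} \<and> fibw (Suc M') = concat bs"
      "set bs' \<subseteq> {fibw m, fibw (Suc m)} \<and> fibw M' = concat bs'"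
      using less.IH[of "Suc M'"] less.IH[of M'] by auto
    then show ?thesis using M' by (intro exI[of _ "bs @ bs'"]) simp
  qed
qed

text \<open>Either \<open>v\<close> starts at a block boundary, or fewer than \<open>l\<close>
  letters of \<open>v\<close> precede the next one; in both cases at least \<open>l\<close> letters
  remain there, enough for \<open>s\<close>.\<close>

lemma sublist_concat_blocks:
  assumes "concat bs = p @ v @ q" "\<And>b. b \<in> set bs \<Longrightarrow> prefix s b \<and> length b \<le> l"
    "2 * l \<le> length v" "0 < l"
  shows "sublist s v"
  using assms(1,2)
proof (induction bs arbitrary: p)
  case Nil
  then show ?case using assms(3,4) by simp
next
  case (Cons b bs)
  have b: "prefix s b" "length b \<le> l" using Cons.prems(2) by auto
  have sl: "length s \<le> l" using b prefix_length_le by fastforce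
  have eq: "b @ concat bs = p @ v @ q" using Cons.prems(1) by simp
  consider "length b \<le> length p" | "p = []" | "p \<noteq> []" "length p < length b" by linarith
  then show ?case
  proof cases
    case 1
    then obtain p' where "p = b @ p'" "concat bs = p' @ v @ q"
      using eq by (auto simp: append_eq_append_conv2)
    then show ?thesis using Cons.IH Cons.prems(2) by simp
  next
    case 2
    then have "prefix s (v @ q)" using eq b(1) by (metis append_Nil prefix_prefix)
    then have "prefix s v" using sl assms(3) prefix_length_prefix[of s "v @ q" v] by simp
    then show ?thesis by blast
  next
    case 3
    obtain r where "b = p @ r \<and> r @ concat bs = v @ q \<or> b @ r = p \<and> concat bs = r @ v @ q"
      using append_eq_append_conv2[of b "concat bs" p "v @ q"] eq by blast
    then have r: "b = p @ r" "v @ q = r @ concat bs" using 3 by auto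
    have rl: "length r < l" using r(1) 3 b(2) by (cases p) auto
    obtain v' where "v = r @ v' \<and> v' @ q = concat bs \<or> v @ v' = r \<and> q = v' @ concat bs"
      using append_eq_append_conv2[of v q r "concat bs"] r(2) by blast
    then have v': "v = r @ v'" "v' @ q = concat bs" using rl assms(3) by auto
    have len: "length v' \<ge> l" "v' \<noteq> []" using v'(1) rl assms(3) by auto
    then obtain b' bs' where bs: "bs = b' # bs'" using v'(2) by (cases bs) auto
    have "prefix s b'" using Cons.prems(2) bs by simp
    then have "prefix s (v' @ q)" unfolding v'(2) bs by simp
    then have "prefix s v'" using sl len(1) prefix_length_prefix[of s "v' @ q" v'] by simp
    then show ?thesis using v'(1) by (auto simp: prefix_def sublist_def)
  qed
qed

text \<open>Words \<open>evenw k'\<close> of large index are products of two consecutive Fibonacci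
  words, both starting with \<open>evenw k\<close>. This is what makes the Fibonacci subshift
  minimal.\<close>

lemma fib_lang_uniformly_recurrent:
  "\<exists>l. \<forall>v\<in>fib_lang. l \<le> length v \<longrightarrow> sublist (evenw k) v"
proof (intro exI ballI impI)
  let ?m = "2 * k + 2"
  let ?l = "length (fibw (Suc ?m))"
  fix v assume v: "v \<in> fib_lang" "2 * ?l \<le> length v"
  then obtain k' where "sublist v (evenw k')" by (auto simp: fib_lang_def)
  then have "sublist v (evenw (max k k'))" using sublist_evenw_mono by auto
  then obtain p q where pq: "evenw (max k k') = p @ v @ q" by (auto simp: sublist_def)
  obtain bs where bs: "set bs \<subseteq> {fibw ?m, fibw (Suc ?m)}" "evenw (max k k') = concat bs"
    unfolding evenw_def using fibw_blocks[of ?m "2 * max k k' + 2"] by auto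
  show "sublist (evenw k) v"
  proof (rule sublist_concat_blocks[of bs p v q])
    show "concat bs = p @ v @ q" using pq bs(2) by simp
    show "prefix (evenw k) b \<and> length b \<le> ?l" if "b \<in> set bs" for b
      using that bs(1) by (auto simp: evenw_def)
    show "0 < ?l" by (simp del: fibw.simps)
  qed (rule v(2))
qed

lemma length_fibw_ge: "n \<le> length (fibw (Suc n))"
proof (induction n)
  case (Suc n)
  have "length (fibw n) \<ge> 1" by (simp add: Suc_leI)
  then show ?case using Suc unfolding fibw.simps length_append by linarith
qed simp

text \<open>The common part \<open>z\<close> in \<open>fibw_near_commute\<close> is followed by both
  \<open>a\<close> and \<open>b\<close>, and so are its suffixes; this gives a right special word of
  every length.\<close>

lemma fib_lang_strictly_growing:
  assumes "\<And>n. finite (level fib_lang n)"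
  shows "strictly_growing fib_lang"
  unfolding strictly_growing_def
proof
  fix n
  obtain z a b where z: "a \<noteq> b" "fibw (Suc (Suc n)) @ fibw (Suc n) = z @ [a, b]"
      "fibw (Suc n) @ fibw (Suc (Suc n)) = z @ [b, a]"
    using fibw_near_commute[of "Suc n"] by blast
  have "length z + 2 = length (fibw (Suc (Suc n))) + length (fibw (Suc n))"
    using arg_cong[OF z(2), of length] by simp
  then have nz: "n \<le> length z" using length_fibw_ge[of n] length_fibw_ge[of "Suc n"] by linarith
  define w where "w = drop (length z - n) z"
  have w: "length w = n" "suffix w z" using nz by (auto simp: w_def suffix_drop)
  have "z @ [a, b] \<in> fib_lang" using fibw_in_fib_lang[of _ "Suc (Suc (Suc n))"] z(2) by simp
  \<comment> \<open>\<open>fibw (n + 4)\<close> is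
    \<open>fibw (n + 2) @ fibw (n + 1) @ fibw (n + 2)\<close>, which ends with
    \<open>z @ [b, a]\<close>.\<close>
  moreover have "z @ [b, a] \<in> fib_lang"
    by (rule fibw_in_fib_lang[of _ "Suc (Suc (Suc (Suc n)))"])
      (unfold z(3)[symmetric] fibw.simps(3)[of "Suc (Suc n)"] fibw.simps(3)[of "Suc n"] append_assoc, rule sublist_append_leftI)
  moreover have "u @ w @ [c] \<in> fib_lang \<Longrightarrow> w @ [c] \<in> fib_lang" for u c
    using ext_langD(1)[OF ext_lang_fib_lang, of u "w @ [c]" "[]"] by simp
  ultimately have "w @ [a] \<in> fib_lang" "w @ [b] \<in> fib_lang"
    using w(2) ext_langD(1)[OF ext_lang_fib_lang, of _ "w @ [a]" "[b]"]
      ext_langD(1)[OF ext_lang_fib_lang, of _ "w @ [b]" "[a]"]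
    by (auto simp: suffix_def)
  then have "w @ [a] \<in> level fib_lang (Suc n)" "w @ [b] \<in> level fib_lang (Suc n)"
    using w(1) by (auto simp: level_def)
  then have "\<not> inj_on butlast (level fib_lang (Suc n))"
    using z(1) inj_onD[of butlast "level fib_lang (Suc n)" "w @ [a]" "w @ [b]"] by auto
  then have "card (butlast ` level fib_lang (Suc n)) \<noteq> card (level fib_lang (Suc n))"
    using eq_card_imp_inj_on[OF assms] by blast
  then show "card (level fib_lang n) < card (level fib_lang (Suc n))"
    using card_image_le[OF assms, of butlast "Suc n"] butlast_level[OF ext_lang_fib_lang] by simp
qed

text \<open>Here \<open>A\<close> and \<open>D\<close> are consecutive Fibonacci words; a window of length \<open>length A\<close> in a product
  of blocks \<open>A\<close> and \<open>A @ D\<close> is a rotation of \<open>A\<close>, unless it begins with the last letter of \<open>D\<close>.\<close>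

lemma windows_of_blocks:
  assumes AD: "A @ D = z @ [a, b]" and DA: "D @ A = z @ [b, a]"
    and DpA: "prefix D A" and D: "D \<noteq> []"
    and bs: "set bs \<subseteq> {A, A @ D}" and v: "length v = length A"
    and eq: "concat bs @ A @ A = p @ v @ q"
  shows "v \<in> insert (last D # take (length A - 1) A) ((\<lambda>r. drop r A @ take r A) ` {..<length A})"
  using bs eq
proof (induction bs arbitrary: p)
  let ?n = "length A"
  have A: "A \<noteq> []" using DpA D by auto
  case Nil
  then have eq: "A @ A = p @ v @ q" by simp
  have len: "length p \<le> ?n" using arg_cong[OF eq, of length] v by simp
  have "v = take ?n (drop (length p) (A @ A))" using eq v by simp
  also have "\<dots> = drop (length p) A @ take (length p) A" using len by simp
  finally show ?case using len A by (cases "length p = ?n") (auto intro!: image_eqI[of _ _ 0])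
next
  let ?n = "length A"
  have A: "A \<noteq> []" using DpA D by auto
  case (Cons c bs)
  define G where "G = concat bs @ A @ A"
  \<comment> \<open>Every block starts with \<open>A\<close>, and the trailing \<open>A @ A\<close>
    keeps this true after the last block.\<close>
  have "\<exists>G'. G = A @ G'" using Cons.prems(1) by (cases bs) (auto simp: G_def)
  then obtain G' where G': "G = A @ G'" by blast
  have lz: "length z + 2 = ?n + length D" using arg_cong[OF AD, of length] by simp
  have takeA: "take r A = take r z" if "r < ?n" for r
  proof -
    have "take r (A @ D) = take r (z @ [a, b])" using AD by simp
    moreover have "r \<le> length z" using that lz D by (cases D) auto
    ultimately show ?thesis using that by simp
  qed
  \<comment> \<open>Since \<open>D @ A\<close> and \<open>A @ D\<close> share \<open>z\<close>, what
    follows the initial \<open>A\<close> of a block \<open>A @ D\<close> agrees with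
    \<open>z\<close>, and by \<open>takeA\<close> with every proper prefix of
    \<open>A\<close>.\<close>
  have takeDG: "take r (D @ G) = take r z" if "r \<le> length z" for r
  proof -
    have "D @ G = (z @ [b, a]) @ G'" using DA G' by (metis append_assoc)
    then show ?thesis using that by simp
  qed
  have eq: "c @ G = p @ v @ q" using Cons.prems(2) by (simp add: G_def)
  show ?case
  proof (cases "length c \<le> length p")
    case True
    then obtain p' where "p = c @ p'" "G = p' @ v @ q"
      using eq by (auto simp: append_eq_append_conv2)
    then show ?thesis using Cons.IH[of p'] Cons.prems(1) by (simp add: G_def)
  next
    case False
    define r where "r = length p"
    have vr: "v = take ?n (drop r (c @ G))" using eq v by (simp add: r_def)
    have small: ?thesis if "r < ?n" "c @ G = A @ Y" "take r Y = take r A" for Y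
    proof -
      have "v = drop r A @ take r A" using vr that by simp
      then show ?thesis using that(1) by blast
    qed
    consider "c = A" | "c = A @ D" "r < ?n" | "c = A @ D" "?n \<le> r" using Cons.prems(1) by fastforce
    then show ?thesis
    proof cases
      case 1
      then show ?thesis using small[of G] False G' by (auto simp: r_def)
    next
      case 2
      then have "r \<le> length z" using lz D by (cases D) auto
      then show ?thesis using small[of "D @ G"] 2 takeDG takeA by simp
    next
      case 3
      define r' where "r' = r - ?n"
      have r': "r' < length D" using 3 False by (auto simp: r'_def r_def)
      have v2: "v = take ?n (drop r' (D @ G))" using vr 3 by (simp add: r'_def)
      show ?thesis
      \<comment> \<open>Among the windows starting inside \<open>D\<close>, only the one at its last
        letter runs beyond \<open>z\<close>; it gives the exceptional word.\<close>
      proof (cases "Suc r' = length D")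
        case True
        then have "drop r' D = [last D]" using D by (metis append_butlast_last_id butlast_conv_take diff_Suc_1 append_eq_conv_conj length_butlast)
        moreover obtain m where "?n = Suc m" using A by (cases A) auto
        ultimately have "v = last D # take (?n - 1) A" using v2 G' r' by simp
        then show ?thesis by blast
      next
        case False
        then have rz: "r' + ?n \<le> length z" using r' lz by linarith
        have "v = drop r' (take (r' + ?n) (D @ G))" using v2 by (simp only: drop_take add_diff_cancel_left')
        also have "\<dots> = drop r' (take (r' + ?n) (A @ D))" using takeDG[OF rz] rz unfolding AD by simp
        also have "\<dots> = take ?n (drop r' (A @ D))" by (simp only: drop_take add_diff_cancel_left')
        also have "\<dots> = drop r' A @ take r' D" using r' prefix_length_le[OF DpA] by simp
        also have "take r' D = take r' A" using DpA r' by (auto simp: prefix_def)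
        finally show ?thesis using r' prefix_length_le[OF DpA] by auto
      qed
    qed
  qed
qed

text \<open>At most \<open>length A\<close> rotations and one exceptional window. These lengths
  suffice because they are the lengths of visits.\<close>

lemma card_level_fib_lang:
  "card (level fib_lang (length (evenw k))) \<le> Suc (length (evenw k))"
proof -
  define A where "A = evenw k"
  define D where "D = fibw (2 * k + 1)"
  have DA: "prefix D A" "D \<noteq> []" by (auto simp: A_def D_def evenw_def)
  have AD: "A @ D = fibw (Suc (2 * k + 2))" by (simp add: A_def D_def evenw_def)
  obtain z a b where z: "A @ D = z @ [a, b]" "D @ A = z @ [b, a]"
    using fibw_near_commute[of "2 * k + 1"] by (auto simp: A_def D_def evenw_def)
  let ?S = "insert (last D # take (length A - 1) A) ((\<lambda>r. drop r A @ take r A) ` {..<length A})"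
  have "level fib_lang (length A) \<subseteq> ?S"
  proof
    fix v assume "v \<in> level fib_lang (length A)"
    then obtain k' where v: "length v = length A" "sublist v (evenw k')" by (auto simp: fib_lang_def level_def)
    then have "sublist v (evenw (max k k'))" using sublist_evenw_mono by auto
    then obtain p q where pq: "evenw (max k k') = p @ v @ q" by (auto simp: sublist_def)
    obtain bs where bs: "set bs \<subseteq> {A, A @ D}" "evenw (max k k') = concat bs"
      unfolding AD unfolding A_def evenw_def using fibw_blocks[of "2 * k + 2" "2 * max k k' + 2"] by auto
    show "v \<in> ?S"
      by (rule windows_of_blocks[OF z DA bs(1) v(1), of p "q @ A @ A"]) (use pq bs(2) in simp)
  qed
  then have "card (level fib_lang (length A)) \<le> card ?S" by (intro card_mono) auto
  also have "\<dots> \<le> Suc (length A)"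
    by (rule order.trans[OF card_insert_le_m1]) (auto intro: order.trans[OF card_image_le])
  finally show ?thesis by (simp add: A_def)
qed

section \<open>A tour through minimal subshifts\<close>

lemma ext_lang_map:
  assumes "ext_lang L" shows "ext_lang (map h ` L)"
  unfolding ext_lang_def
proof (intro conjI allI impI ballI)
  show "[] \<in> map h ` L" using assms by (auto simp: ext_lang_def)
next
  fix u v w assume "u @ v @ w \<in> map h ` L"
  then obtain z where z: "z \<in> L" "map h z = u @ v @ w" by force
  then obtain u' z' where u': "z = u' @ z'" "map h z' = v @ w"
    using map_eq_append_conv[of h z u "v @ w"] by metis
  then obtain v' w' where "z' = v' @ w'" "v = map h v'"
    using map_eq_append_conv[of h z' v w] by metis
  then show "v \<in> map h ` L" using ext_langD(1)[OF assms, of u' v' w'] z(1) u'(1) by blast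
next
  fix w assume "w \<in> map h ` L"
  then obtain w' where w': "w' \<in> L" "w = map h w'" by blast
  then obtain a where "w' @ [a] \<in> L" using ext_langE[OF assms] by metis
  then have "map h (w' @ [a]) \<in> map h ` L" by (rule imageI)
  then show "\<exists>a. w @ [a] \<in> map h ` L" using w'(2) by (intro exI[of _ "h a"]) simp
next
  fix w assume "w \<in> map h ` L"
  then obtain w' where w': "w' \<in> L" "w = map h w'" by blast
  then obtain a where "a # w' \<in> L" using ext_langE[OF assms] by metis
  then have "map h (a # w') \<in> map h ` L" by (rule imageI)
  then show "\<exists>a. a # w \<in> map h ` L" using w'(2) by (intro exI[of _ "h a"]) simp
qed

lemma level_map: "level (map h ` L) n = map h ` level L n"
  by (auto simp: level_def)

lemma ext_lang_sublist: "ext_lang L \<Longrightarrow> v \<in> L \<Longrightarrow> sublist w v \<Longrightarrow> w \<in> L"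
  unfolding sublist_def using ext_langD(1) by blast

lemma set_fib_lang: "v \<in> fib_lang \<Longrightarrow> set v \<subseteq> {0, 1}"
  using set_fibw set_mono_sublist unfolding fib_lang_def evenw_def by blast

lemma finite_level_fib_lang: "finite (level fib_lang n)"
proof (rule finite_subset)
  show "level fib_lang n \<subseteq> {w. set w \<subseteq> {0, 1} \<and> length w = n}"
    using set_fib_lang by (auto simp: level_def)
  show "finite {w :: nat list. set w \<subseteq> {0, 1} \<and> length w = n}"
    by (rule finite_lists_length_eq) simp
qed

lemma transitive_subshift_closure:
  assumes "finite A" "range x \<subseteq> A"
  shows "transitive_subshift A {z. factors z \<subseteq> factors x}"
proof -
  have eq: "{z. factors z \<subseteq> factors x} = full_shift A closure_of orbit x"
    using closure_of_orbit[OF assms(2)] by simp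
  have fs: "factors (shift n z) \<subseteq> factors z" for n z
    by (auto simp: factors_def block_shift)
  have "shift 1 ` {z. factors z \<subseteq> factors x} = {z. factors z \<subseteq> factors x}"
  proof
    show "shift 1 ` {z. factors z \<subseteq> factors x} \<subseteq> {z. factors z \<subseteq> factors x}"
      using fs by blast
    show "{z. factors z \<subseteq> factors x} \<subseteq> shift 1 ` {z. factors z \<subseteq> factors x}"
    proof
      fix z assume z: "z \<in> {z. factors z \<subseteq> factors x}"
      have "z = shift 1 (shift (-1) z)" by (simp add: shift_shift)
      moreover have "shift (-1) z \<in> {z. factors z \<subseteq> factors x}" using z fs by blast
      ultimately show "z \<in> shift 1 ` {z. factors z \<subseteq> factors x}" by blast
    qed
  qed
  moreover have "closedin (full_shift A) {z. factors z \<subseteq> factors x}" unfolding eq by simp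
  ultimately show ?thesis
    unfolding transitive_subshift_def subshift_def using assms(1) eq by blast
qed

text \<open>Even words are nested as suffixes. This makes the left half of the tour consistent and,
  together with \<open>take_evenw_eq\<close>, makes transitions at different times look
  alike.\<close>

lemma drop_evenw_eq:
  assumes "r \<le> length (evenw k)" "r \<le> length (evenw l)"
  shows "drop (length (evenw k) - r) (evenw k) = drop (length (evenw l) - r) (evenw l)"
proof -
  have "drop (length (evenw k) - r) (evenw k) = drop (length (evenw l) - r) (evenw l)"
    if kl: "k \<le> l" "r \<le> length (evenw k)" for k l
  proof -
    obtain u where "evenw l = u @ evenw k" using evenw_mono(2)[OF kl(1)] by (auto simp: suffix_def)
    then show ?thesis using kl(2) by simp
  qed
  then show ?thesis using assms by (metis nle_le)
qed

lemma take_evenw_eq: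
  assumes "r \<le> length (evenw k)" "r \<le> length (evenw l)"
  shows "take r (evenw k) = take r (evenw l)"
proof -
  have "take r (evenw k) = take r (evenw l)" if kl: "k \<le> l" "r \<le> length (evenw k)" for k l
  proof -
    obtain u where "evenw l = evenw k @ u" using evenw_mono(1)[OF kl(1)] by (auto simp: prefix_def)
    then show ?thesis using kl(2) by simp
  qed
  then show ?thesis using assms by (metis nle_le)
qed

lemma length_evenw_gt: "k < length (evenw k)"
proof (induction k)
  case (Suc k)
  then show ?case using length_evenw_less[of k] by linarith
qed simp

section \<open>The tour point\<close>

locale tour =
  fixes j i :: nat and \<kappa> :: "nat \<Rightarrow> nat"
  assumes j: "3 \<le> j" and ij: "i \<le> j" and \<kappa>: "strict_mono \<kappa>"
begin

text \<open>The subsystem \<open>a\<close> has the letters \<open>2 * a\<close> and \<open>2 * a + 1\<close>. For \<open>a \<ge> i\<close> the Fibonacci words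
  are collapsed to powers of \<open>2 * a\<close>, so that the length of \<open>W a k\<close> does not depend on \<open>a\<close>.\<close>

definition letter :: "nat \<Rightarrow> nat \<Rightarrow> nat" where
  "letter a b = 2 * a + (if a < i then b else 0)"

definition W :: "nat \<Rightarrow> nat \<Rightarrow> nat list" where
  "W a k = map (letter a) (evenw k)"

definition \<Lambda> :: "nat \<Rightarrow> nat list set" where
  "\<Lambda> a = map (letter a) ` fib_lang"

text \<open>Subsystem \<open>0\<close> is reserved for the left half; the visits on the right go
  round the others.\<close>

definition stop :: "nat \<Rightarrow> nat" where
  "stop t = Suc (t mod (j - 1))"

definition v :: "nat \<Rightarrow> nat" where
  "v t = length (evenw (\<kappa> t))"

definition S :: "nat \<Rightarrow> nat" where
  "S t = (\<Sum>s<t. v s)"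

definition R :: "nat \<Rightarrow> nat list" where
  "R t = concat (map (\<lambda>s. W (stop s) (\<kappa> s)) [0..<t])"

text \<open>A coordinate \<open>k \<ge> 0\<close> is read from \<open>R (k + 1)\<close>, which has
  more than \<open>k\<close> letters since every visit is nonempty. Coordinate \<open>- r\<close> is
  the \<open>r\<close>-th letter from the end of \<open>W 0 r\<close>, which has more than
  \<open>r\<close> letters; by nested suffixes every longer \<open>W 0 m\<close> gives the same
  letter.\<close>

definition x :: "int \<Rightarrow> nat" where
  "x k = (if 0 \<le> k then R (Suc (nat k)) ! nat k
          else W 0 (nat (- k)) ! (length (W 0 (nat (- k))) - nat (- k)))"

definition A :: "nat set" where "A = {..<2 * j}"

definition X :: "(int \<Rightarrow> nat) set" where "X = {z. factors z \<subseteq> factors x}"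

definition Y :: "nat \<Rightarrow> (int \<Rightarrow> nat) set" where "Y a = {z. factors z \<subseteq> \<Lambda> a}"

lemma length_W [simp]: "length (W a k) = length (evenw k)"
  by (simp add: W_def)

lemma S_Suc [simp]: "S (Suc t) = S t + v t"
  by (simp add: S_def)

lemma S_0 [simp]: "S 0 = 0"
  by (simp add: S_def)

lemma v_strict_mono: "strict_mono v"
  using strict_mono_compose[OF strict_mono_length_evenw \<kappa>] by (simp add: v_def[abs_def] o_def)

lemma v_pos: "0 < v t"
  by (simp add: v_def)

lemma S_mono: "s \<le> t \<Longrightarrow> S s \<le> S t"
  unfolding S_def by (rule sum_mono2) auto

lemma S_ge: "t \<le> S t"
proof (induction t)
  case (Suc t)
  then show ?case using v_pos[of t] by simp
qed simp

lemma R_Suc: "R (Suc t) = R t @ W (stop t) (\<kappa> t)"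
  by (simp add: R_def)

lemma length_R [simp]: "length (R t) = S t"
  by (induction t) (auto simp: R_Suc v_def, simp add: R_def)

lemma R_nth: "s \<le> t \<Longrightarrow> n < S s \<Longrightarrow> R t ! n = R s ! n"
proof (induction t rule: dec_induct)
  case (step t)
  then show ?case using S_mono[of s t] by (simp add: R_Suc nth_append)
qed simp

lemma x_nonneg: "n < S t \<Longrightarrow> x (int n) = R t ! n"
  using R_nth[of t "Suc n" n] R_nth[of "Suc n" t n] S_ge[of "Suc n"]
  by (cases "t \<le> Suc n") (auto simp: x_def simp del: S_Suc)

lemma block_visit: "block x (int (S t)) (v t) = W (stop t) (\<kappa> t)"
proof (rule nth_equalityI)
  fix n assume "n < length (block x (int (S t)) (v t))"
  then have n: "n < v t" by simp
  then have "block x (int (S t)) (v t) ! n = x (int (S t + n))" by (simp add: nth_block)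
  also have "\<dots> = R (Suc t) ! (S t + n)" using n by (intro x_nonneg) simp
  also have "\<dots> = W (stop t) (\<kappa> t) ! n" by (simp add: R_Suc nth_append)
  finally show "block x (int (S t)) (v t) ! n = W (stop t) (\<kappa> t) ! n" .
qed (simp add: v_def)

lemma block_past: "block x (- int (length (evenw m))) (length (evenw m)) = W 0 m"
proof (rule nth_equalityI)
  let ?l = "length (evenw m)"
  fix n assume "n < length (block x (- int ?l) ?l)"
  then have n: "n < ?l" by simp
  define r where "r = ?l - n"
  have r: "0 < r" "r \<le> ?l" "r \<le> length (evenw r)"
    using n length_evenw_gt[of r] by (auto simp: r_def)
  have "block x (- int ?l) ?l ! n = x (- int r)" using n by (simp add: nth_block r_def of_nat_diff)
  also have "\<dots> = W 0 r ! (length (evenw r) - r)" using r by (simp add: x_def)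
  also have "\<dots> = hd (drop (length (evenw r) - r) (W 0 r))"
    using r by (intro hd_drop_conv_nth[symmetric]) auto
  also have "drop (length (evenw r) - r) (W 0 r) = drop (?l - r) (W 0 m)"
    unfolding W_def drop_map using drop_evenw_eq[OF r(3,2)] by simp
  also have "hd (drop (?l - r) (W 0 m)) = W 0 m ! n"
    using n by (subst hd_drop_conv_nth) (auto simp: r_def)
  finally show "block x (- int ?l) ?l ! n = W 0 m ! n" .
qed simp

lemma ext_lang_\<Lambda>: "ext_lang (\<Lambda> a)"
  unfolding \<Lambda>_def by (rule ext_lang_map[OF ext_lang_fib_lang])

lemma W_in_\<Lambda>: "W a k \<in> \<Lambda> a"
  by (auto simp: W_def \<Lambda>_def evenw_in_fib_lang)

lemma \<Lambda>_sublist_W: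
  assumes "w \<in> \<Lambda> a" obtains k where "\<And>l. k \<le> l \<Longrightarrow> sublist w (W a l)"
proof -
  obtain w' k where k: "w = map (letter a) w'" "sublist w' (evenw k)"
    using assms by (auto simp: \<Lambda>_def fib_lang_def)
  have "sublist w (W a l)" if "k \<le> l" for l
    using sublist_evenw_mono[OF k(2) that] unfolding k(1) W_def by (rule map_mono_sublist)
  then show thesis using that by blast
qed

lemma \<Lambda>_uniformly_recurrent: "\<exists>l. \<forall>w\<in>\<Lambda> a. l \<le> length w \<longrightarrow> sublist (W a k) w"
proof -
  obtain l where l: "\<forall>w\<in>fib_lang. l \<le> length w \<longrightarrow> sublist (evenw k) w"
    using fib_lang_uniformly_recurrent by blast
  have "sublist (W a k) w" if w: "w \<in> \<Lambda> a" "l \<le> length w" for w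
  proof -
    obtain w' where w': "w' \<in> fib_lang" "w = map (letter a) w'" using w(1) by (auto simp: \<Lambda>_def)
    then have "sublist (evenw k) w'" using l w(2) by simp
    then show ?thesis unfolding w'(2) W_def by (rule map_mono_sublist)
  qed
  then show ?thesis by blast
qed

text \<open>Minimality in terms of languages: by uniform recurrence a long word of
  \<open>\<Lambda> a\<close> contains a given \<open>W a k\<close>, hence any given word of
  \<open>\<Lambda> a\<close>.\<close>

lemma \<Lambda>_subset:
  assumes "ext_lang L" "\<And>n. \<exists>w\<in>L. w \<in> \<Lambda> a \<and> n \<le> length w"
  shows "\<Lambda> a \<subseteq> L"
proof
  fix w assume "w \<in> \<Lambda> a"
  then obtain k where k: "sublist w (W a k)" by (metis \<Lambda>_sublist_W order_refl)
  obtain l where "\<forall>w\<in>\<Lambda> a. l \<le> length w \<longrightarrow> sublist (W a k) w" using \<Lambda>_uniformly_recurrent by blast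
  then obtain u where "u \<in> L" "sublist (W a k) u" using assms(2)[of l] by blast
  then show "w \<in> L" using ext_lang_sublist[OF assms(1)] k sublist_order.order_trans by blast
qed

lemma \<Lambda>_letters: "w \<in> \<Lambda> a \<Longrightarrow> b \<in> set w \<Longrightarrow> b div 2 = a \<and> (i \<le> a \<longrightarrow> b = 2 * a)"
proof -
  assume "w \<in> \<Lambda> a" "b \<in> set w"
  then obtain w' c where "w' \<in> fib_lang" "c \<in> set w'" "b = letter a c" by (auto simp: \<Lambda>_def)
  moreover then have "c = 0 \<or> c = 1" using set_fib_lang by blast
  ultimately show ?thesis by (auto simp: letter_def)
qed

lemma set_\<Lambda>: "a < j \<Longrightarrow> w \<in> \<Lambda> a \<Longrightarrow> set w \<subseteq> A"
  using \<Lambda>_letters by (fastforce simp: A_def)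

lemma stop_less: "stop t < j"
proof -
  have "t mod (j - 1) < j - 1" using j by (intro mod_less_divisor) simp
  then show ?thesis by (simp add: stop_def)
qed

lemma stop_Suc: "stop (Suc t) = Suc (stop t mod (j - 1))"
  by (simp add: stop_def mod_Suc_eq)

lemma block_in_past: "k + int n \<le> 0 \<Longrightarrow> block x k n \<in> \<Lambda> 0"
proof -
  assume k: "k + int n \<le> 0"
  define m where "m = nat (- k)"
  have m: "m < length (evenw m)" by (rule length_evenw_gt)
  have "block x (- int (length (evenw m))) (length (evenw m)) \<in> \<Lambda> 0"
    by (simp add: block_past W_in_\<Lambda>)
  then show "block x k n \<in> \<Lambda> 0"
    by (rule ext_lang_sub_block[OF ext_lang_\<Lambda>]) (use k m in \<open>auto simp: m_def\<close>)
qed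

lemma block_in_visit: "int (S t) \<le> k \<Longrightarrow> k + int n \<le> int (S (Suc t)) \<Longrightarrow> block x k n \<in> \<Lambda> (stop t)"
  using ext_lang_sub_block[OF ext_lang_\<Lambda>, of x "int (S t)" "v t" "stop t" k n]
  by (simp add: block_visit W_in_\<Lambda>)

lemma visit_at:
  assumes "S s \<le> n" obtains t where "s \<le> t" "S t \<le> n" "n < S (Suc t)"
proof -
  have bnd: "t \<le> n" if "S t \<le> n" for t using S_ge[of t] that by simp
  define t where "t = Max {t. S t \<le> n}"
  have fin: "finite {t. S t \<le> n}" by (rule finite_subset[of _ "{..n}"]) (auto dest: bnd)
  have "S t \<le> n" using Max_in[OF fin] assms unfolding t_def by blast
  moreover have "s \<le> t" unfolding t_def using fin assms by (intro Max_ge) auto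
  moreover have "n < S (Suc t)"
    using Max_ge[OF fin, of "Suc t"] by (fastforce simp: t_def simp del: S_Suc)
  ultimately show thesis using that by blast
qed

lemma range_x: "range x \<subseteq> A"
proof
  fix b assume "b \<in> range x"
  then obtain k where k: "b = x k" by blast
  have "block x k 1 = [b]" using k by (simp add: block_def)
  moreover have "\<exists>a<j. block x k 1 \<in> \<Lambda> a"
  proof (cases "k < 0")
    case True
    then have "block x k 1 \<in> \<Lambda> 0" by (intro block_in_past) simp
    then show ?thesis using j by (intro exI[of _ 0]) simp
  next
    case False
    obtain t where "S t \<le> nat k" "nat k < S (Suc t)" using visit_at[of 0 "nat k"] by auto
    then have "block x k 1 \<in> \<Lambda> (stop t)" using False by (intro block_in_visit) auto
    then show ?thesis using stop_less by blast
  qed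
  ultimately show "b \<in> A" using set_\<Lambda> by fastforce
qed

section \<open>Minimal subsystems of the tour\<close>

lemma finite_A: "finite A"
  by (simp add: A_def)

lemma transitive_X: "transitive_subshift A X"
  unfolding X_def by (rule transitive_subshift_closure[OF finite_A range_x])

lemma \<Lambda>_visited:
  assumes "a < j" shows "\<Lambda> a \<subseteq> factors x"
proof
  fix w assume "w \<in> \<Lambda> a"
  then obtain k where k: "\<And>l. k \<le> l \<Longrightarrow> sublist w (W a l)" by (metis \<Lambda>_sublist_W)
  have "\<exists>l\<ge>k. W a l \<in> factors x"
  proof (cases "a = 0")
    case True
    then show ?thesis using block_past[of k] by (metis block_in_factors order_refl)
  next
    case False
    then obtain b where b: "a = Suc b" "b < j - 1" using assms by (cases a) auto
    \<comment> \<open>The visits to \<open>a\<close> are those numbered \<open>b\<close> modulo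
      \<open>j - 1\<close>; this one has number at least \<open>k\<close>, and therefore word index
      at least \<open>k\<close>.\<close>
    define t where "t = (j - 1) * k + b"
    have "stop t = a" unfolding stop_def t_def mod_mult_self4 using b by simp
    moreover have "t \<le> \<kappa> t" using \<kappa> by (rule strict_mono_imp_increasing)
    moreover have "1 * k \<le> (j - 1) * k" using j by (intro mult_right_mono) auto
    then have "k \<le> t" unfolding t_def by linarith
    ultimately show ?thesis using block_visit[of t] by (metis block_in_factors order_trans)
  qed
  then show "w \<in> factors x" using k ext_lang_sublist[OF ext_lang_factors] by blast
qed

lemma Y_factors: "z \<in> Y a \<Longrightarrow> factors z = \<Lambda> a"
proof
  assume z: "z \<in> Y a"
  then show "factors z \<subseteq> \<Lambda> a" by (simp add: Y_def)
  have "block z 0 n \<in> \<Lambda> a" for n using z block_in_factors by (auto simp: Y_def)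
  then show "\<Lambda> a \<subseteq> factors z"
    by (intro \<Lambda>_subset[OF ext_lang_factors]) (metis block_in_factors length_block order_refl)
qed

lemma Y_nonempty: "a < j \<Longrightarrow> Y a \<noteq> {}"
proof -
  assume a: "a < j"
  obtain z where "factors z \<subseteq> \<Lambda> a"
  proof (rule konig[OF finite_A, of "\<Lambda> a"])
    show "\<exists>w\<in>\<Lambda> a. n \<le> length w" for n
      using ext_lang_level_nonempty[OF ext_lang_\<Lambda>[of a], of n] by (auto simp: level_def)
  qed (use set_\<Lambda>[OF a] ext_langD(1)[OF ext_lang_\<Lambda>] in auto)
  then show ?thesis by (auto simp: Y_def)
qed

lemma Y_eq: "z \<in> Y a \<Longrightarrow> Y a = {y. factors y \<subseteq> factors z}"
  by (subst Y_factors) (assumption, rule Y_def)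

lemma minimal_Y:
  assumes "a < j" shows "minimal_subshift A (Y a)"
proof -
  have range: "range z \<subseteq> A" if "z \<in> Y a" for z
  proof
    fix b assume "b \<in> range z"
    then obtain k where "b = z k" by blast
    then have "[b] = block z k 1" by (simp add: block_def)
    then have "[b] \<in> \<Lambda> a" using Y_factors[OF that] block_in_factors[of z k 1] by simp
    then show "b \<in> A" using set_\<Lambda>[OF assms] by fastforce
  qed
  obtain z where z: "z \<in> Y a" using Y_nonempty[OF assms] by blast
  have sub: "subshift A (Y a)"
    using transitive_subshift_closure[OF finite_A range[OF z]]
    unfolding Y_eq[OF z] transitive_subshift_def by blast
  have closure: "Y a = full_shift A closure_of orbit y" if "y \<in> Y a" for y
    unfolding closure_of_orbit[OF range[OF that]] by (rule Y_eq[OF that])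
  show ?thesis unfolding minimal_subshift_def
    by (intro conjI ballI sub closure Y_nonempty[OF assms])
qed

text \<open>After time \<open>S n\<close> every visit lasts at least \<open>n\<close>, so a block of
  length \<open>n\<close> within a single visit is found soon. This excludes further minimal
  subsystems.\<close>

lemma window_contains_visit:
  "\<exists>H. \<forall>k. \<exists>l a. k \<le> l \<and> l + int n \<le> k + int H \<and> a < j \<and> block x l n \<in> \<Lambda> a"
proof -
  have vn: "n \<le> v t" if "n \<le> t" for t
    using strict_mono_imp_increasing[OF v_strict_mono, of t] that by linarith
  have "\<exists>l a. k \<le> l \<and> l + int n \<le> k + int (S n + 4 * n) \<and> a < j \<and> block x l n \<in> \<Lambda> a" for k
  proof (cases "k + int n \<le> 0")
    case True
    then show ?thesis using block_in_past j by (intro exI[of _ k] exI[of _ 0]) auto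
  next
    case False
    \<comment> \<open>Position \<open>q\<close> is at most \<open>S n + n\<close> beyond
      \<open>k\<close>, and if the block at \<open>q\<close> crosses a boundary, that boundary is
      less than \<open>n\<close> beyond \<open>q\<close>; so \<open>S n + 4 * n\<close> leaves room
      for a block starting there.\<close>
    define q where "q = nat (max k (int (S n)))"
    have q: "k \<le> int q" "int q \<le> k + int (S n + n)" "S n \<le> q"
      using False by (auto simp: q_def)
    obtain t where t: "n \<le> t" "S t \<le> q" "q < S (Suc t)" using visit_at[OF q(3)] by blast
    show ?thesis
    proof (cases "q + n \<le> S (Suc t)")
      case True
      have "block x (int q) n \<in> \<Lambda> (stop t)"
        by (rule block_in_visit) (use t True in \<open>simp_all del: S_Suc\<close>)
      then show ?thesis using q stop_less by (intro exI[of _ "int q"] exI[of _ "stop t"]) auto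
    next
      case False
      have "block x (int (S (Suc t))) n \<in> \<Lambda> (stop (Suc t))"
        using vn[of "Suc t"] t(1) by (intro block_in_visit) auto
      moreover have "k \<le> int (S (Suc t))" "int (S (Suc t)) + int n \<le> k + int (S n + 4 * n)"
        using q t(3) False by linarith+
      ultimately show ?thesis using stop_less by blast
    qed
  qed
  then show ?thesis by blast
qed

text \<open>A point of a minimal subsystem contains, at every length, a word of some
  \<open>\<Lambda> a\<close>. The pigeonhole principle fixes one \<open>a\<close> for infinitely
  many lengths, and then all of \<open>\<Lambda> a\<close> occurs in the point.\<close>

lemma minimal_subsystems_X: "minimal_subsystems A X = Y ` {..<j}"
proof
  show "Y ` {..<j} \<subseteq> minimal_subsystems A X"
  proof (intro image_subsetI)
    fix a assume "a \<in> {..<j}"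
    then have a: "a < j" by simp
    have "Y a \<subseteq> X" using \<Lambda>_visited[OF a] unfolding X_def Y_def by blast
    then show "Y a \<in> minimal_subsystems A X" using minimal_Y[OF a] by (simp add: minimal_subsystems_def)
  qed
  show "minimal_subsystems A X \<subseteq> Y ` {..<j}"
  proof
    fix M assume "M \<in> minimal_subsystems A X"
    then have M: "minimal_subshift A M" "M \<subseteq> X" by (auto simp: minimal_subsystems_def)
    then obtain m where m: "m \<in> M" by (auto simp: minimal_subshift_def)
    have "\<exists>a<j. \<exists>w\<in>factors m. w \<in> \<Lambda> a \<and> length w = n" for n
    proof -
      obtain H where H: "\<And>k. \<exists>l a. k \<le> l \<and> l + int n \<le> k + int H \<and> a < j \<and> block x l n \<in> \<Lambda> a"
        using window_contains_visit[of n] by blast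
      have "m \<in> X" using m M(2) by blast
      then have "block m 0 H \<in> factors x" using block_in_factors[of m 0 H] unfolding X_def by blast
      then obtain k where k: "block m 0 H = block x k H" by (metis factorsE length_block)
      obtain l a where l: "k \<le> l" "l + int n \<le> k + int H" "a < j" "block x l n \<in> \<Lambda> a" using H by blast
      have "block x k H \<in> factors m" using k by (metis block_in_factors)
      then have "block x l n \<in> factors m" by (rule ext_lang_sub_block[OF ext_lang_factors]) (use l in auto)
      then show ?thesis using l(3,4) length_block by blast
    qed
    then obtain f where f: "\<And>n. f n < j" "\<And>n. \<exists>w\<in>factors m. w \<in> \<Lambda> (f n) \<and> length w = n" by metis
    have "range f \<subseteq> {..<j}" using f(1) by auto
    then have "finite (range f)" by (rule finite_subset) simp
    then obtain n0 where n0: "infinite {n. f n = f n0}"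
      using pigeonhole_infinite[of UNIV f] by auto
    have "\<Lambda> (f n0) \<subseteq> factors m"
    proof (rule \<Lambda>_subset[OF ext_lang_factors])
      fix n
      obtain n' where "n' \<ge> n" "f n' = f n0" using n0 unfolding infinite_nat_iff_unbounded_le by blast
      then show "\<exists>w\<in>factors m. w \<in> \<Lambda> (f n0) \<and> n \<le> length w" using f(2)[of n'] by auto
    qed
    moreover obtain y where y: "y \<in> Y (f n0)" using Y_nonempty[OF f(1)] by blast
    ultimately have "y \<in> M" using minimal_subshift_eq[OF M(1) m] Y_factors[OF y] by simp
    then have "M = {z. factors z \<subseteq> factors y}" using minimal_subshift_eq[OF M(1)] by blast
    then have "M = Y (f n0)" using Y_eq[OF y] by simp
    then show "M \<in> Y ` {..<j}" using f(1) by blast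
  qed
qed

lemma inj_Y: "inj_on Y {..<j}"
proof (rule inj_onI)
  fix a b assume ab: "a \<in> {..<j}" "b \<in> {..<j}" "Y a = Y b"
  then obtain z where z: "z \<in> Y a" "z \<in> Y b" using Y_nonempty[of a] by auto
  then have "W a 0 \<in> \<Lambda> b" using W_in_\<Lambda>[of a 0] Y_factors by metis
  moreover have "hd (W a 0) \<in> set (W a 0)" by (metis evenw_nonempty hd_in_set length_W length_0_conv)
  ultimately show "a = b" using \<Lambda>_letters[OF W_in_\<Lambda>] \<Lambda>_letters by metis
qed

lemma card_level_\<Lambda>:
  "a < i \<Longrightarrow> card (level (\<Lambda> a) n) = card (level fib_lang n)"
  "i \<le> a \<Longrightarrow> card (level (\<Lambda> a) n) \<le> 1"
proof -
  assume "a < i"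
  then have "inj (letter a)" by (simp add: inj_def letter_def)
  then show "card (level (\<Lambda> a) n) = card (level fib_lang n)"
    unfolding \<Lambda>_def level_map by (intro card_image inj_on_subset[OF inj_mapI]) auto
next
  assume a: "i \<le> a"
  have "level (\<Lambda> a) n \<subseteq> {replicate n (2 * a)}"
    using \<Lambda>_letters a by (auto simp: level_def intro!: replicate_eqI)
  then show "card (level (\<Lambda> a) n) \<le> 1"
    using card_mono[of "{replicate n (2 * a)}" "level (\<Lambda> a) n"] by simp
qed

lemma infinite_Y:
  assumes "a < j" shows "infinite (Y a) \<longleftrightarrow> a < i"
proof
  assume "infinite (Y a)"
  show "a < i"
  proof (rule ccontr)
    assume c: "\<not> a < i"
    have "z = (\<lambda>_. 2 * a)" if "z \<in> Y a" for z
    proof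
      fix k
      have "block z k 1 \<in> \<Lambda> a" using Y_factors[OF that] block_in_factors[of z k 1] by simp
      then show "z k = 2 * a" using \<Lambda>_letters[of "block z k 1" a "z k"] c by (simp add: block_def)
    qed
    then have "Y a \<subseteq> {\<lambda>_. 2 * a}" by blast
    then show False using \<open>infinite (Y a)\<close> finite_subset by blast
  qed
next
  assume a: "a < i"
  show "infinite (Y a)"
  proof
    \<comment> \<open>A finite \<open>Y a\<close> would bound the number of words of every length,
      while the Fibonacci counts are unbounded.\<close>
    assume fin: "finite (Y a)"
    have grow: "n \<le> card (level (\<Lambda> a) n)" for n
    proof (induction n)
      case (Suc n)
      then show ?case
        using fib_lang_strictly_growing[OF finite_level_fib_lang] card_level_\<Lambda>(1)[OF a]
        by (simp add: strictly_growing_def) (metis Suc_leI le_less_trans)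
    qed simp
    let ?n = "Suc (card (Y a))"
    obtain z where z: "z \<in> Y a" using Y_nonempty[OF assms] by blast
    have "level (\<Lambda> a) ?n \<subseteq> (\<lambda>y. block y 0 ?n) ` Y a"
    proof
      fix w assume "w \<in> level (\<Lambda> a) ?n"
      then obtain k where "w = block z k ?n" using Y_factors[OF z] level_factors[of z ?n] by auto
      then have "w = block (shift k z) 0 ?n" by (simp add: block_shift)
      moreover have "shift k z \<in> Y a"
        using subshift_shift[OF _ z, of A] minimal_Y[OF assms] by (simp add: minimal_subshift_def)
      ultimately show "w \<in> (\<lambda>y. block y 0 ?n) ` Y a" by blast
    qed
    then have "card (level (\<Lambda> a) ?n) \<le> card (Y a)" using fin surj_card_le by blast
    then show False using grow[of ?n] by simp
  qed
qed

lemma card_minimal_subsystems_X: "card (minimal_subsystems A X) = j"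
  unfolding minimal_subsystems_X using card_image[OF inj_Y] by simp

lemma card_infinite_minimal_subsystems_X: "card {M \<in> minimal_subsystems A X. infinite M} = i"
proof -
  have "{M \<in> Y ` {..<j}. infinite M} = Y ` {a \<in> {..<j}. infinite (Y a)}" by blast
  also have "{a \<in> {..<j}. infinite (Y a)} = {a \<in> {..<j}. a < i}" using infinite_Y by auto
  also have "\<dots> = {..<i}" using ij by auto
  finally have "{M \<in> Y ` {..<j}. infinite M} = Y ` {..<i}" .
  moreover have "inj_on Y {..<i}" using inj_Y ij by (auto intro: inj_on_subset)
  ultimately show ?thesis unfolding minimal_subsystems_X by (simp add: card_image)
qed

section \<open>Counting the words of the tour\<close>

definition transition :: "nat \<Rightarrow> nat \<Rightarrow> nat \<Rightarrow> nat list" where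
  "transition t a r = drop (v t - r) (W a (\<kappa> t)) @ take (v t - r) (W (Suc (a mod (j - 1))) (\<kappa> t))"

text \<open>The window consists of a suffix of one visit and a prefix of the next. As even words are
  nested at both ends, both parts can be read from the words of index \<open>\<kappa> t\<close>. The
  bound \<open>t \<le> Suc s\<close> allows the visit being left to be shorter than the
  window.\<close>

lemma block_transition:
  assumes st: "t \<le> Suc s" and k: "S s \<le> k" "k < S (Suc s)" "S (Suc s) < k + v t"
  shows "block x (int k) (v t) = transition t (stop s) (S (Suc s) - k)"
proof -
  define r where "r = S (Suc s) - k"
  have kr: "k + r = S (Suc s)" using k(2) unfolding r_def by linarith
  have r: "r \<le> v t" "r \<le> v s" using k kr S_Suc[of s] by linarith+
  have int_kr: "int k + int r = int (S (Suc s))" using kr by (metis of_nat_add)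
  have vt: "v t \<le> v (Suc s)" using st v_strict_mono by (simp add: strict_mono_less_eq)
  have "block x (int k) (v t) = block x (int k) r @ block x (int (S (Suc s))) (v t - r)"
    using block_add[of x "int k" r "v t - r"] r(1) unfolding int_kr by simp
  also have "block x (int k) r = drop (v s - r) (W (stop s) (\<kappa> s))"
  proof -
    have "S s + (v s - r) = k" using r(2) kr S_Suc[of s] by linarith
    then have k_eq: "int (S s) + int (v s - r) = int k" by (metis of_nat_add)
    have "block x (int (S s)) (v s - r + r) = block x (int (S s)) (v s - r) @ block x (int k) r"
      unfolding block_add k_eq ..
    then have "W (stop s) (\<kappa> s) = block x (int (S s)) (v s - r) @ block x (int k) r"
      using block_visit[of s] r(2) by simp
    then show ?thesis by simp
  qed
  also have "\<dots> = drop (v t - r) (W (stop s) (\<kappa> t))"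
    unfolding W_def drop_map v_def using drop_evenw_eq[of r "\<kappa> s" "\<kappa> t"] r by (simp add: v_def)
  also have "block x (int (S (Suc s))) (v t - r) = take (v t - r) (W (stop (Suc s)) (\<kappa> (Suc s)))"
    using take_block[of "v t - r" "v (Suc s)" x "int (S (Suc s))"] vt block_visit[of "Suc s"] by simp
  also have "\<dots> = take (v t - r) (W (stop (Suc s)) (\<kappa> t))"
    unfolding W_def take_map using take_evenw_eq[of "v t - r" "\<kappa> (Suc s)" "\<kappa> t"] vt by (simp add: v_def)
  finally show ?thesis unfolding transition_def r_def stop_Suc .
qed

text \<open>With \<open>n = v (Suc t)\<close>, a window starting at or after \<open>S t\<close>
  meets at most two visits. The languages contribute at most \<open>j + i * n\<close> words, the
  start positions between \<open>- n\<close> and \<open>S t\<close> at most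
  \<open>n + S t - 1\<close>, and the transitions, given by a stop and a cut, at most
  \<open>(j - 1) * (n - 1)\<close>.\<close>

lemma complexity_X:
  "complexity X (v (Suc t)) \<le> (j + i) * v (Suc t) + j + S t"
proof -
  define n where "n = v (Suc t)"
  have n: "0 < n" using v_pos by (simp add: n_def)
  let ?L = "\<Union>a<j. level (\<Lambda> a) n"
  let ?I = "(\<lambda>k. block x k n) ` {- int n<..<int (S t)}"
  let ?T = "case_prod (transition (Suc t)) ` ({1..<j} \<times> {1..<n})"
  have finL: "finite (level (\<Lambda> a) n)" for a
    unfolding \<Lambda>_def level_map using finite_level_fib_lang by blast
  have "words X n = level (factors x) n"
    by (rule words_orbit_closure) (auto simp: X_def)
  also have "\<dots> \<subseteq> ?L \<union> ?I \<union> ?T"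
  proof
    fix w assume "w \<in> level (factors x) n"
    then obtain k where k: "w = block x k n" by (auto simp: level_factors)
    have L: "w \<in> ?L" if "block x k n \<in> \<Lambda> a" "a < j" for a
      using that k by (auto simp: level_def)
    consider "k + int n \<le> 0" | "- int n < k" "k < int (S t)" | "int (S t) \<le> k" by linarith
    then show "w \<in> ?L \<union> ?I \<union> ?T"
    proof cases
      case 1
      then show ?thesis using L[OF block_in_past] j by simp
    next
      case 2
      then show ?thesis using k by auto
    next
      case 3
      define q where "q = nat k"
      have q: "k = int q" "S t \<le> q" using 3 by (auto simp: q_def)
      obtain s where s: "t \<le> s" "S s \<le> q" "q < S (Suc s)" using visit_at[OF q(2)] by blast
      show ?thesis
      proof (cases "q + n \<le> S (Suc s)")
        case True
        have "block x k n \<in> \<Lambda> (stop s)" unfolding q(1)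
          by (rule block_in_visit) (use s True in \<open>simp_all del: S_Suc\<close>)
        then show ?thesis using L stop_less by blast
      next
        case False
        have "w = transition (Suc t) (stop s) (S (Suc s) - q)"
          unfolding k q(1) n_def by (rule block_transition) (use s False in \<open>auto simp: n_def\<close>)
        moreover have "stop s \<in> {1..<j}" using stop_less by (auto simp: stop_def)
        moreover have "S (Suc s) - q \<in> {1..<n}" using s False by (auto simp del: S_Suc)
        ultimately show ?thesis by (auto intro!: rev_image_eqI)
      qed
    qed
  qed
  finally have "complexity X n \<le> card (?L \<union> ?I \<union> ?T)"
    unfolding complexity_def using finL by (intro card_mono) auto
  also have "\<dots> \<le> card ?L + card ?I + card ?T"
    using card_Un_le[of "?L \<union> ?I" ?T] card_Un_le[of ?L ?I] by linarith
  also have "card ?T \<le> (j - 1) * (n - 1)"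
    using card_image_le[of "{1..<j} \<times> {1..<n}"] by (simp add: card_cartesian_product)
  also have "card ?I \<le> n + S t - 1"
    using card_image_le[of "{- int n<..<int (S t)}" "\<lambda>k. block x k n"] by simp
  also have "card ?L \<le> (\<Sum>a<j. card (level (\<Lambda> a) n))"
    using card_UN_le by blast
  also have "\<dots> \<le> (\<Sum>a<j. if a < i then n + 1 else 1)"
    using card_level_\<Lambda> card_level_fib_lang[of "\<kappa> (Suc t)"]
    by (intro sum_mono) (auto simp: n_def v_def)
  also have "\<dots> = (\<Sum>a<j. 1 + (if a < i then n else 0))" by (rule sum.cong) auto
  also have "\<dots> = j + i * n"
  proof -
    have "(\<Sum>a<j. if a \<in> {..<i} then n else 0) = (\<Sum>a\<in>{..<j} \<inter> {..<i}. n)"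
      by (rule sum.inter_restrict[symmetric]) simp
    also have "{..<j} \<inter> {..<i} = {..<i}" using ij by auto
    finally show ?thesis by (simp only: sum.distrib lessThan_iff) simp
  qed
  also have "j + i * n + (n + S t - 1) + (j - 1) * (n - 1) \<le> (j + i) * n + j + S t"
  proof -
    obtain j' n' where "j = Suc j'" "n = Suc n'" using j n by (metis gr0_conv_Suc less_le_trans zero_less_numeral)
    then show ?thesis by (simp add: algebra_simps)
  qed
  finally show ?thesis by (simp add: n_def)
qed

end

section \<open>Choice of the visits and the limit superior\<close>

lemma exists_fast_tour:
  fixes g :: "nat \<Rightarrow> nat"
  assumes "mono g" "\<not> bdd_above (range g)"
  shows "\<exists>\<kappa> :: nat \<Rightarrow> nat. strict_mono \<kappa> \<and>
    (\<forall>t. (\<Sum>s<t. length (evenw (\<kappa> s))) \<le> g (length (evenw (\<kappa> t))))"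
proof -
  let ?len = "\<lambda>k. length (evenw k)"
  have large: "\<exists>k'>k. m \<le> g (?len k')" for k m
  proof -
    have "\<exists>n. m \<le> g n"
    proof (rule ccontr)
      assume "\<not> ?thesis"
      then have "bdd_above (range g)" by (intro bdd_aboveI[of _ m]) (auto simp: not_le less_imp_le)
      with assms(2) show False ..
    qed
    then obtain n where n: "m \<le> g n" ..
    define k' where "k' = max (Suc k) n"
    have "n \<le> ?len k'" using length_evenw_gt[of k'] by (simp add: k'_def)
    then have "m \<le> g (?len k')" using n monoD[OF assms(1)] order_trans by blast
    then show ?thesis by (intro exI[of _ k']) (simp add: k'_def)
  qed
  \<comment> \<open>The recursion carries the index \<open>\<kappa> t\<close> together with the
    total length of all earlier visits.\<close>
  obtain f where f: "\<And>n. snd (f n) \<le> g (?len (fst (f n))) \<and> (n = 0 \<longrightarrow> snd (f n) = 0)"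
    "\<And>n. fst (f n) < fst (f (Suc n)) \<and> snd (f (Suc n)) = snd (f n) + ?len (fst (f n))"
  proof (rule exE[OF dependent_nat_choice[where
        P = "\<lambda>n p. snd p \<le> g (?len (fst p)) \<and> (n = 0 \<longrightarrow> snd p = 0)" and
        Q = "\<lambda>n p q. fst p < fst q \<and> snd q = snd p + ?len (fst p)"]])
    show "\<exists>p. snd p \<le> g (?len (fst p)) \<and> (0 = 0 \<longrightarrow> snd p = 0)"
      by (intro exI[of _ "(0, 0)"]) simp
  next
    fix p :: "nat \<times> nat" and n :: nat
    obtain k where "k > fst p" "snd p + ?len (fst p) \<le> g (?len k)" using large by blast
    then show "\<exists>q. (snd q \<le> g (?len (fst q)) \<and> (Suc n = 0 \<longrightarrow> snd q = 0)) \<and>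
        fst p < fst q \<and> snd q = snd p + ?len (fst p)"
      by (intro exI[of _ "(k, snd p + ?len (fst p))"]) simp
  qed blast
  have "snd (f t) = (\<Sum>s<t. ?len (fst (f s)))" for t
    by (induction t) (simp_all add: f)
  then have "(\<Sum>s<t. ?len (fst (f s))) \<le> g (?len (fst (f t)))" for t using f(1)[of t] by simp
  moreover have "strict_mono (\<lambda>n. fst (f n))" using f(2) by (simp add: strict_mono_Suc_iff)
  ultimately show ?thesis by (intro exI[of _ "\<lambda>n. fst (f n)"]) simp
qed

text \<open>The difference is eventually nondecreasing, and being an integer it gains at least one
  at each of infinitely many strict increases; so it even tends to infinity.\<close>

lemma limsup_infinity_of_growth:
  fixes c :: "nat \<Rightarrow> nat" and d :: nat
  assumes "\<And>n. N \<le> n \<Longrightarrow> c n + d \<le> c (Suc n)" "\<And>m. \<exists>n\<ge>m. c n + d < c (Suc n)"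
  shows "limsup (\<lambda>n. ereal (real (c n) - real d * real n)) = \<infinity>"
proof -
  define D where "D n = int (c n) - int d * int n" for n
  have Suc: "D n \<le> D (Suc n)" if "N \<le> n" for n
    using assms(1)[OF that] by (simp add: D_def algebra_simps)
  have mono: "D m \<le> D n" if "N \<le> m" "m \<le> n" for m n
    using that(2)
  proof (induction n rule: dec_induct)
    case (step n)
    then show ?case using Suc[of n] that(1) by simp
  qed simp
  have unb: "\<exists>n\<ge>N. D N + int q \<le> D n" for q
  proof (induction q)
    case (Suc q)
    then obtain m where m: "N \<le> m" "D N + int q \<le> D m" by blast
    obtain n where n: "m \<le> n" "c n + d < c (Suc n)" using assms(2) by blast
    have "D n < D (Suc n)" using n(2) by (simp add: D_def algebra_simps)
    then have "D N + int (Suc q) \<le> D (Suc n)" using mono[OF m(1) n(1)] m(2) by simp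
    then show ?case using m n by (intro exI[of _ "Suc n"]) simp
  qed auto
  have "(\<lambda>n. ereal (real (c n) - real d * real n)) \<longlonglongrightarrow> \<infinity>"
    unfolding tendsto_PInfty eventually_sequentially
  proof
    fix r :: real
    obtain q :: nat where q: "r - real_of_int (D N) < real q" using reals_Archimedean2 by blast
    obtain m where m: "N \<le> m" "D N + int q \<le> D m" using unb by blast
    have "r < real (c n) - real d * real n" if "m \<le> n" for n
    proof -
      have "D N + int q \<le> D n" using mono[OF m(1) that] m(2) by simp
      then have "real_of_int (D N + int q) \<le> real_of_int (D n)" by (rule of_int_le_iff[THEN iffD2])
      then have "real_of_int (D N) + real q \<le> real (c n) - real d * real n" by (simp add: D_def)
      then show ?thesis using q by linarith
    qed
    then show "\<exists>m. \<forall>n\<ge>m. ereal r < ereal (real (c n) - real d * real n)" by auto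
  qed
  then show ?thesis by (intro lim_imp_Limsup) simp_all
qed

lemma growth_iterate:
  fixes c :: "nat \<Rightarrow> nat"
  assumes "\<And>n. N \<le> n \<Longrightarrow> c n + d \<le> c (Suc n)" "N \<le> n" "n \<le> m"
  shows "c n + d * (m - n) \<le> c m"
  using assms(3)
proof (induction m rule: dec_induct)
  case (step m)
  then show ?case using assms(1)[of m] assms(2) by (simp add: Suc_diff_le)
qed simp

theorem theorem4p3:
  fixes j i :: nat
  assumes "j \<ge> 3" and "i \<le> j"
  shows "(\<forall>(A :: 'a set) X.
            transitive_subshift A X \<and>
            card (minimal_subsystems A X) = j \<and>
            card {Y \<in> minimal_subsystems A X. infinite Y} = i
            \<longrightarrow> limsup (\<lambda>n. ereal (real (complexity X n) - real (j + i) * real n)) = \<infinity>)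
       \<and> (\<forall>g :: nat \<Rightarrow> nat. mono g \<and> \<not> bdd_above (range g) \<longrightarrow>
            (\<exists>(A :: nat set) X.
               transitive_subshift A X \<and>
               card (minimal_subsystems A X) = j \<and>
               card {Y \<in> minimal_subsystems A X. infinite Y} = i \<and>
               limsup (\<lambda>n. ereal (real (complexity X n)
                                   - (real (j + i) * real n + real (g n)))) \<noteq> \<infinity>))"
proof (intro conjI allI impI)
  fix A :: "'a set" and X
  assume "transitive_subshift A X \<and> card (minimal_subsystems A X) = j \<and>
      card {Y \<in> minimal_subsystems A X. infinite Y} = i"
  then obtain N where "\<And>n. N \<le> n \<Longrightarrow> complexity X n + (j + i) \<le> complexity X (Suc n)"
      "\<And>m. \<exists>n\<ge>m. complexity X n + (j + i) < complexity X (Suc n)"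
    using transitive_growth[of A X j i] assms(1) by auto
  then show "limsup (\<lambda>n. ereal (real (complexity X n) - real (j + i) * real n)) = \<infinity>"
    by (rule limsup_infinity_of_growth)
next
  fix g :: "nat \<Rightarrow> nat"
  assume "mono g \<and> \<not> bdd_above (range g)"
  then have g: "mono g" "\<not> bdd_above (range g)" by auto
  obtain \<kappa> :: "nat \<Rightarrow> nat" where fast: "strict_mono \<kappa>" "\<forall>t. (\<Sum>s<t. length (evenw (\<kappa> s))) \<le> g (length (evenw (\<kappa> t)))"
    using exists_fast_tour[OF g] by blast
  interpret tour j i \<kappa> using assms fast(1) by unfold_locales
  have Sg: "S t \<le> g (v t)" for t using fast(2) by (simp add: S_def v_def)
  \<comment> \<open>The growth bound of the first half is applied to the tour itself, to control
    lengths between those of two visits.\<close>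
  obtain N where N: "\<And>n. N \<le> n \<Longrightarrow> complexity X n + (j + i) \<le> complexity X (Suc n)"
    using transitive_growth[OF transitive_X card_minimal_subsystems_X assms(1)
        card_infinite_minimal_subsystems_X] by auto
  have bound: "complexity X n \<le> (j + i) * n + j + g n" if n: "max N (v 0) \<le> n" for n
  proof -
    have bnd: "t \<le> n" if "v t \<le> n" for t
      using strict_mono_imp_increasing[OF v_strict_mono, of t] that by linarith
    \<comment> \<open>\<open>n\<close> lies between the lengths of visits \<open>t\<close> and
      \<open>t + 1\<close>. The growth bound is run backwards from \<open>v (Suc t)\<close>, and
      \<open>S t \<le> g (v t) \<le> g n\<close> by the choice of the visits.\<close>
    define t where "t = Max {t. v t \<le> n}"
    have fin: "finite {t. v t \<le> n}" by (rule finite_subset[of _ "{..n}"]) (auto dest: bnd)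
    have "0 \<in> {t. v t \<le> n}" using n by simp
    then have t: "v t \<le> n" using Max_in[OF fin] unfolding t_def by blast
    have t': "n \<le> v (Suc t)"
      using Max_ge[OF fin, of "Suc t"] by (fastforce simp: t_def)
    have "complexity X n + (j + i) * (v (Suc t) - n) \<le> complexity X (v (Suc t))"
      by (rule growth_iterate[of N]) (use N n t' in auto)
    also have "\<dots> \<le> (j + i) * v (Suc t) + j + S t" by (rule complexity_X)
    also have "(j + i) * v (Suc t) = (j + i) * n + (j + i) * (v (Suc t) - n)"
      using t' by (metis add_mult_distrib2 le_add_diff_inverse)
    finally have "complexity X n \<le> (j + i) * n + j + S t" by linarith
    also have "S t \<le> g n" using Sg[of t] monoD[OF g(1) t] by linarith
    finally show ?thesis by simp
  qed
  have "limsup (\<lambda>n. ereal (real (complexity X n) - (real (j + i) * real n + real (g n)))) \<le> ereal (real j)"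
  proof (rule Limsup_bounded)
    show "\<forall>\<^sub>F n in sequentially.
        ereal (real (complexity X n) - (real (j + i) * real n + real (g n))) \<le> ereal (real j)"
      unfolding eventually_sequentially
    proof (intro exI allI impI)
      fix n assume "max N (v 0) \<le> n"
      then have "real (complexity X n) \<le> real ((j + i) * n + j + g n)"
        using bound[of n] by (simp only: of_nat_le_iff)
      then show "ereal (real (complexity X n) - (real (j + i) * real n + real (g n))) \<le> ereal (real j)"
        by (simp only: ereal_less_eq of_nat_add of_nat_mult)
    qed
  qed
  then have "limsup (\<lambda>n. ereal (real (complexity X n) - (real (j + i) * real n + real (g n)))) \<noteq> \<infinity>"
    by auto
  then show "\<exists>(A :: nat set) X.
      transitive_subshift A X \<and> card (minimal_subsystems A X) = j \<and>
      card {Y \<in> minimal_subsystems A X. infinite Y} = i \<and>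
      limsup (\<lambda>n. ereal (real (complexity X n) - (real (j + i) * real n + real (g n)))) \<noteq> \<infinity>"
    using transitive_X card_minimal_subsystems_X card_infinite_minimal_subsystems_X by blast
qed

end
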